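(* Let $\hat f_i$ denote the Fourier transform of the velocity distribution function $f_i$ of species $i$, and let $\hat Q_{ij}(\boldsymbol\zeta)$ and $\hat Q_{ij}^{kl}(\boldsymbol\zeta)$ denote the Fourier transforms of the partial elastic collision operator $Q_{ij}$ and of the partial inelastic collision operator $Q_{ij}^{kl}$. Then these can be written as weighted convolutions in Fourier space: for all $i,j\in\mathcal S$, $$\hat Q_{ij}(\boldsymbol\zeta)=\int_{\mathbb R^3}\hat f_i(\boldsymbol\zeta-\boldsymbol\xi)\,\hat f_j(\boldsymbol\xi)\,\hat W_{ij}(\boldsymbol\zeta,\boldsymbol\xi)\,d\boldsymbol\xi ,$$ and for all $i\in\mathcal S$, $(j,k,l)\in\mathcal C_i^{\rm in}$, $$\hat Q_{ij}^{kl}(\boldsymbol\zeta)=\int_{\mathbb R^3}\left[\hat f_k(\boldsymbol\zeta-\boldsymbol\xi)\,\hat f_l(\boldsymbol\xi)\,\hat G_{ij}^{kl}(\boldsymbol\zeta,\boldsymbol\xi)-\hat f_i(\boldsymbol\zeta-\boldsymbol\xi)\,\hat f_j(\boldsymbol\xi)\,\hat L_{ij}^{kl}(\boldsymbol\xi)\right]d\boldsymbol\xi ,$$ where the convolution weights are $$\hat W_{ij}(\boldsymbol\zeta,\boldsymbol\xi)=\frac{1}{(2\pi)^{3/2}}\int_{\mathbb R^3}\int_{S^2}u\,\sigma_{ij}\left\{\exp\left[-\imath\frac{\mu_{ij}}{m_i}\boldsymbol\zeta\cdot(\mathbf u'-\mathbf u)\right]-1\right\}\exp(-\imath\,\boldsymbol\xi\cdot\mathbf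 u)\,d\boldsymbol\omega'\,d\mathbf u,$$ $$\hat G_{ij}^{kl}(\boldsymbol\zeta,\boldsymbol\xi)=\frac{1}{(2\pi)^{3/2}}\int_{\mathbb R^3}\int_{S^2}u'\,\sigma_{kl}^{ij}\exp\left[-\imath\frac{\mu_{ij}}{m_i}\boldsymbol\zeta\cdot(\mathbf u-\mathbf u')\right]\exp(-\imath\,\boldsymbol\xi\cdot\mathbf u')\,d\boldsymbol\omega\,d\mathbf u',$$ $$\hat L_{ij}^{kl}(\boldsymbol\xi)=\frac{1}{(2\pi)^{3/2}}\int_{\mathbb R^3}\int_{S^2}u\,\sigma_{ij}^{kl}\exp(-\imath\,\boldsymbol\xi\cdot\mathbf u)\,d\boldsymbol\omega'\,d\mathbf u ,$$ and $\mu_{ij}=m_im_j/(m_i+m_j)$ is the reduced mass of the species $i$ and $j$. (In the formula for $\hat G_{ij}^{kl}$ the relation $\mu_{ij}=\mu_{kl}$, valid for a multi-energy level gas, has been used.) In $\hat W_{ij}$, $u=|\mathbf u|$ and $\mathbf u'=u\,\boldsymbol\omega'$; in $\hat G_{ij}^{kl}$, $u'=|\mathbf u'|$ and $\mathbf u=\sqrt{u'^2+2\Delta E_{ij}^{kl}/\mu_{ij}}\;\boldsymbol\omega$; in $\hat L_{ij}^{kl}$, $u=|\mathbf u|$.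
   Context: Setting. $\mathcal S=\{1,\dots,N_s\}$ indexes the species (internal energy levels) of a dilute gas. Species $i$ has mass $m_i$, internal energy $E_i$, degeneracy $g_i$ and velocity distribution function $f_i$ on $\mathbb R^3$. In a multi-energy level gas all masses are equal; species indices on the masses are kept so as to include mixtures of monatomic gases without internal energy, where the masses may differ and only elastic collisions occur. Put $\Delta E_{ij}^{kl}=E_k+E_l-E_i-E_j$. The inelastic collision set is $\mathcal C_i^{\rm in}=\mathcal S^3\setminus\{(s,i,s): s\in\mathcal S\}$; a triple $(j,k,l)\in\mathcal C_i^{\rm in}$ stands for the collision $i+j\to k+l$. Collision kinematics. For pre-collisional velocities $\mathbf v_i,\mathbf v_j\in\mathbb R^3$ put $\mathbf u=\mathbf v_i-\mathbf v_j$, $u=|\mathbf u|$, $\boldsymbol\omega=\mathbf u/u$. Primed variables are post-collisional values, related to the pre-collisional ones through conservation of mass, momentum and energy: for the scattering direction $\boldsymbol\omega'\in S^2$, $\mathbf u'=u'\boldsymbol\omega'$ with $u'=u$ for an elastic collision and $u'=\sqrt{u^2-2\Delta E_{ij}^{kl}/\mu_{ij}}$ for the inelastic collision $i+j\to k+l$, and $\mathbf v_i'=\frac{m_i\mathbf v_i+m_j\mathbf v_j}{m_i+m_j}+\frac{\mu_{ij}}{m_i}\mathbf u'$, $\mathbf v_j'=\frac{m_i\mathbf v_i+m_j\mathbf v_j}{m_i+m_j}-\frac{\mu_{ij}}{m_j}\mathbf u'$. Cross-sections. $\sigma_{ij}$ (elastic) and $\sigma_{ij}^{kl}$ (inelastic,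 for $i+j\to k+l$) are the differential cross-sections; no particular form is assumed for them and anisotropic interactions are allowed. Energetically impossible collisions do not contribute: $\sigma_{ij}^{kl}$ is zero when $u^2<2\Delta E_{ij}^{kl}/\mu_{ij}$, and $\sigma_{kl}^{ij}$ is zero when $u'^2<-2\Delta E_{ij}^{kl}/\mu_{ij}$. In $\sigma_{kl}^{ij}$, the cross-section of the inverse collision $k+l\to i+j$, the incoming relative velocity is $\mathbf u'$ and the outgoing one is $\mathbf u$. The cross-sections satisfy the micro-reversibility relations $$\sigma_{ij}\,u\,d\boldsymbol\omega'\,d\mathbf v_j\,d\mathbf v_i=\sigma_{ij}\,u'\,d\boldsymbol\omega\,d\mathbf v_j'\,d\mathbf v_i',\qquad g_ig_j\,\sigma_{ij}^{kl}\,u\,d\boldsymbol\omega'\,d\mathbf v_j\,d\mathbf v_i=g_kg_l\,\sigma_{kl}^{ij}\,u'\,d\boldsymbol\omega\,d\mathbf v_j'\,d\mathbf v_i'.$$ Collision operators. $$Q_{ij}(\mathbf v_i)=\int_{\mathbb R^3}\int_{S^2}\left[f_i(\mathbf v_i')f_j(\mathbf v_j')-f_i(\mathbf v_i)f_j(\mathbf v_j)\right]\sigma_{ij}\,u\,d\boldsymbol\omega'\,d\mathbf v_j,$$ $$Q_{ij}^{kl}(\mathbf v_i)=\int_{\mathbb R^3}\int_{S^2}\left[\frac{g_ig_j}{g_kg_l}f_k(\mathbf v_i')f_l(\mathbf v_j')-f_i(\mathbf v_i)f_j(\mathbf v_j)\right]\sigma_{ij}^{kl}\,u\,d\boldsymbol\omega'\,d\mathbf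 v_j.$$ Fourier transform convention: $\hat f(\boldsymbol\zeta)=(2\pi)^{-3/2}\int_{\mathbb R^3}e^{-\imath\boldsymbol\zeta\cdot\mathbf v}f(\mathbf v)\,d\mathbf v$, where $\imath$ is the imaginary unit.
   Formalization: Added: each f_i is integrable and square integrable; cross-sections are measurable and nonnegative; the integrals defining Q_ij, its Fourier transform and the weights W, L (hence G) converge absolutely. Without this the displayed integrals may diverge (e.g. untruncated hard spheres). *)

theory Defs
  imports "HOL-Analysis.Analysis"
begin

type_synonym vec3 = "real^3"

section \<open>The unit sphere\<close>

text \<open>The surface measure of the unit sphere, as a Borel measure on the ambient space that is
  concentrated on the sphere: a set of directions has three times the volume of the part of the
  unit ball it spans.  The centre of the ball, where the direction \<^term>\<open>sgn x\<close> is not a unit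
  vector, is a null set.\<close>

definition sphere_measure :: "vec3 measure" where
  "sphere_measure = distr (density lborel (\<lambda>x. 3 * indicator (ball 0 1) x)) borel sgn"

lemma sets_sphere_measure [measurable_cong, simp]: "sets sphere_measure = sets borel"
  by (simp add: sphere_measure_def)

lemma space_sphere_measure [simp]: "space sphere_measure = UNIV"
  by (simp add: sphere_measure_def)

lemma AE_sphere_measure: "AE \<omega> in sphere_measure. \<omega> \<in> sphere 0 1"
proof -
  have [measurable]: "(sgn :: vec3 \<Rightarrow> vec3) \<in> borel_measurable borel"
    by (simp add: sgn_div_norm[abs_def])
  have [measurable]: "ball (0::vec3) 1 \<in> sets borel"
    by (simp add: borel_open)
  have "AE x in lborel. x \<noteq> (0::vec3)"
    by (rule AE_lborel_singleton)
  then show ?thesis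
    unfolding sphere_measure_def
    by (subst AE_distr_iff) (auto simp: AE_density norm_sgn elim: eventually_mono)
qed

lemma emeasure_sphere_measure: "emeasure sphere_measure UNIV = ennreal (4 * pi)"
proof -
  have [measurable]: "(sgn :: vec3 \<Rightarrow> vec3) \<in> borel_measurable borel"
    by (simp add: sgn_div_norm[abs_def])
  have [measurable]: "ball (0::vec3) 1 \<in> sets borel"
    by (simp add: borel_open)
  have "emeasure sphere_measure UNIV = 3 * emeasure lborel (ball (0::vec3) 1)"
    by (simp add: sphere_measure_def emeasure_distr emeasure_density nn_integral_cmult)
  also have "emeasure lborel (ball (0::vec3) 1) = ennreal (unit_ball_vol 3)"
    by (simp add: emeasure_ball)
  also have "3 * \<dots> = ennreal (4 * pi)"
    by (simp add: unit_ball_vol_3 flip: ennreal_numeral ennreal_mult)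
  finally show ?thesis .
qed


section \<open>Species and collision kinematics\<close>

definition species :: "nat \<Rightarrow> nat set" where
  "species N = {1..N}"

text \<open>A triple \<open>(j, k, l)\<close> stands for the collision \<open>i + j \<rightarrow> k + l\<close>.\<close>

definition inelastic_collisions :: "nat \<Rightarrow> nat \<Rightarrow> (nat \<times> nat \<times> nat) set" where
  "inelastic_collisions N i =
     species N \<times> species N \<times> species N - {(s, i, s) | s. s \<in> species N}"

definition energy_gap :: "(nat \<Rightarrow> real) \<Rightarrow> nat \<Rightarrow> nat \<Rightarrow> nat \<Rightarrow> nat \<Rightarrow> real" where
  "energy_gap E i j k l = E k + E l - E i - E j"

definition reduced_mass :: "real \<Rightarrow> real \<Rightarrow> real" where
  "reduced_mass a b = a * b / (a + b)"

text \<open>The relative speed after a collision with reduced mass \<open>\<mu>\<close> and energy gap \<open>\<Delta>\<close>.  Below the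
  threshold the value is meaningless; the cross-section vanishes there.\<close>

definition inelastic_speed :: "real \<Rightarrow> real \<Rightarrow> real \<Rightarrow> real" where
  "inelastic_speed \<mu> \<Delta> u = sqrt (u\<^sup>2 - 2 * \<Delta> / \<mu>)"

text \<open>Post-collisional velocities of particles with masses \<open>a\<close>, \<open>b\<close> and velocities \<open>v\<close>, \<open>w\<close>,
  in terms of the post-collisional relative velocity \<open>u'\<close>.\<close>

definition post_fst :: "real \<Rightarrow> real \<Rightarrow> vec3 \<Rightarrow> vec3 \<Rightarrow> vec3 \<Rightarrow> vec3" where
  "post_fst a b v w u' = (a *\<^sub>R v + b *\<^sub>R w) /\<^sub>R (a + b) + (reduced_mass a b / a) *\<^sub>R u'"

definition post_snd :: "real \<Rightarrow> real \<Rightarrow> vec3 \<Rightarrow> vec3 \<Rightarrow> vec3 \<Rightarrow> vec3" where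
  "post_snd a b v w u' = (a *\<^sub>R v + b *\<^sub>R w) /\<^sub>R (a + b) - (reduced_mass a b / b) *\<^sub>R u'"

text \<open>The change of variables \<open>(v\<^sub>i, v\<^sub>j, \<omega>') \<mapsto> (v\<^sub>i', v\<^sub>j', \<omega>)\<close>, where the post-collisional relative
  speed is the function \<open>s\<close> of the pre-collisional one.\<close>

definition collision_map ::
    "real \<Rightarrow> real \<Rightarrow> (real \<Rightarrow> real) \<Rightarrow> vec3 \<times> vec3 \<times> vec3 \<Rightarrow> vec3 \<times> vec3 \<times> vec3" where
  "collision_map a b s = (\<lambda>(v, w, \<omega>').
     let u' = s (norm (v - w)) *\<^sub>R \<omega>'
     in (post_fst a b v w u', post_snd a b v w u', sgn (v - w)))"


section \<open>Micro-reversibility\<close>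

text \<open>A cross-section is a function of the incoming relative velocity (a vector) and of the
  outgoing direction; only its values at unit outgoing directions matter.\<close>

type_synonym cross_section = "vec3 \<Rightarrow> vec3 \<Rightarrow> real"

definition collision_space :: "(vec3 \<times> vec3 \<times> vec3) measure" where
  "collision_space = lborel \<Otimes>\<^sub>M (lborel \<Otimes>\<^sub>M sphere_measure)"

text \<open>The measure \<open>\<sigma> u d\<omega>' dv\<^sub>j dv\<^sub>i\<close>.\<close>

definition collision_measure :: "cross_section \<Rightarrow> (vec3 \<times> vec3 \<times> vec3) measure" where
  "collision_measure \<sigma> =
     density collision_space (\<lambda>(v, w, \<omega>'). ennreal (\<sigma> (v - w) \<omega>' * norm (v - w)))"

text \<open>Micro-reversibility identifies a differential in the variables \<open>(v\<^sub>i, v\<^sub>j, \<omega>')\<close> with one in the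
  variables \<open>(v\<^sub>i', v\<^sub>j', \<omega>)\<close>: transported along the change of variables, the first measure becomes
  the second one.\<close>

definition elastic_reversible ::
    "(nat \<Rightarrow> real) \<Rightarrow> (nat \<Rightarrow> nat \<Rightarrow> cross_section) \<Rightarrow> nat \<Rightarrow> nat \<Rightarrow> bool" where
  "elastic_reversible m \<sigma> i j \<longleftrightarrow>
     distr (collision_measure (\<sigma> i j)) collision_space (collision_map (m i) (m j) (\<lambda>u. u))
     = collision_measure (\<sigma> i j)"

definition inelastic_reversible ::
    "(nat \<Rightarrow> real) \<Rightarrow> (nat \<Rightarrow> real) \<Rightarrow> (nat \<Rightarrow> real) \<Rightarrow>
     (nat \<Rightarrow> nat \<Rightarrow> nat \<Rightarrow> nat \<Rightarrow> cross_section) \<Rightarrow> nat \<Rightarrow> nat \<Rightarrow> nat \<Rightarrow> nat \<Rightarrow> bool" where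
  "inelastic_reversible m E g \<tau> i j k l \<longleftrightarrow>
     distr (collision_measure (\<lambda>u \<omega>'. g i * g j * \<tau> i j k l u \<omega>')) collision_space
       (collision_map (m i) (m j)
         (inelastic_speed (reduced_mass (m i) (m j)) (energy_gap E i j k l)))
     = collision_measure (\<lambda>u' \<omega>. g k * g l * \<tau> k l i j u' \<omega>)"


section \<open>Collision operators\<close>

definition Q_elastic_integrand ::
    "(nat \<Rightarrow> real) \<Rightarrow> (nat \<Rightarrow> nat \<Rightarrow> cross_section) \<Rightarrow> (nat \<Rightarrow> vec3 \<Rightarrow> real) \<Rightarrow>
     nat \<Rightarrow> nat \<Rightarrow> vec3 \<Rightarrow> vec3 \<Rightarrow> vec3 \<Rightarrow> real" where
  "Q_elastic_integrand m \<sigma> f i j v w \<omega>' =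
     (let u = v - w; u' = norm u *\<^sub>R \<omega>'
      in (f i (post_fst (m i) (m j) v w u') * f j (post_snd (m i) (m j) v w u') - f i v * f j w)
         * \<sigma> i j u \<omega>' * norm u)"

definition Q_elastic ::
    "(nat \<Rightarrow> real) \<Rightarrow> (nat \<Rightarrow> nat \<Rightarrow> cross_section) \<Rightarrow> (nat \<Rightarrow> vec3 \<Rightarrow> real) \<Rightarrow>
     nat \<Rightarrow> nat \<Rightarrow> vec3 \<Rightarrow> real" where
  "Q_elastic m \<sigma> f i j v =
     (LINT w|lborel. LINT \<omega>'|sphere_measure. Q_elastic_integrand m \<sigma> f i j v w \<omega>')"

definition Q_inelastic ::
    "(nat \<Rightarrow> real) \<Rightarrow> (nat \<Rightarrow> real) \<Rightarrow> (nat \<Rightarrow> real) \<Rightarrow>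
     (nat \<Rightarrow> nat \<Rightarrow> nat \<Rightarrow> nat \<Rightarrow> cross_section) \<Rightarrow> (nat \<Rightarrow> vec3 \<Rightarrow> real) \<Rightarrow>
     nat \<Rightarrow> nat \<Rightarrow> nat \<Rightarrow> nat \<Rightarrow> vec3 \<Rightarrow> real" where
  "Q_inelastic m E g \<tau> f i j k l v =
     (LINT w|lborel. LINT \<omega>'|sphere_measure.
       (let u = v - w;
            u' = inelastic_speed (reduced_mass (m i) (m j)) (energy_gap E i j k l) (norm u) *\<^sub>R \<omega>'
        in (g i * g j / (g k * g l)
              * f k (post_fst (m i) (m j) v w u') * f l (post_snd (m i) (m j) v w u')
            - f i v * f j w)
           * \<tau> i j k l u \<omega>' * norm u))"


section \<open>Fourier transform and convolution weights\<close>

definition fourier :: "(vec3 \<Rightarrow> real) \<Rightarrow> vec3 \<Rightarrow> complex" where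
  "fourier f \<zeta> = complex_of_real ((2 * pi) powr (-3/2)) *
     (LINT v|lborel. exp (- \<i> * complex_of_real (\<zeta> \<bullet> v)) * complex_of_real (f v))"

definition W_integrand ::
    "(nat \<Rightarrow> real) \<Rightarrow> (nat \<Rightarrow> nat \<Rightarrow> cross_section) \<Rightarrow> nat \<Rightarrow> nat \<Rightarrow>
     vec3 \<Rightarrow> vec3 \<Rightarrow> vec3 \<Rightarrow> vec3 \<Rightarrow> complex" where
  "W_integrand m \<sigma> i j \<zeta> \<xi> u \<omega>' =
     (let u' = norm u *\<^sub>R \<omega>'
      in complex_of_real (norm u * \<sigma> i j u \<omega>')
         * (exp (- \<i> * complex_of_real (reduced_mass (m i) (m j) / m i * (\<zeta> \<bullet> (u' - u)))) - 1)
         * exp (- \<i> * complex_of_real (\<xi> \<bullet> u)))"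

definition W_weight ::
    "(nat \<Rightarrow> real) \<Rightarrow> (nat \<Rightarrow> nat \<Rightarrow> cross_section) \<Rightarrow> nat \<Rightarrow> nat \<Rightarrow>
     vec3 \<Rightarrow> vec3 \<Rightarrow> complex" where
  "W_weight m \<sigma> i j \<zeta> \<xi> = complex_of_real (1 / (2 * pi) powr (3/2)) *
     (LINT u|lborel. LINT \<omega>'|sphere_measure. W_integrand m \<sigma> i j \<zeta> \<xi> u \<omega>')"

text \<open>The integration variables are those of the inverse collision \<open>k + l \<rightarrow> i + j\<close>, whose energy
  gap is the opposite of that of \<open>i + j \<rightarrow> k + l\<close>.\<close>

definition G_weight ::
    "(nat \<Rightarrow> real) \<Rightarrow> (nat \<Rightarrow> real) \<Rightarrow> (nat \<Rightarrow> nat \<Rightarrow> nat \<Rightarrow> nat \<Rightarrow> cross_section) \<Rightarrow>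
     nat \<Rightarrow> nat \<Rightarrow> nat \<Rightarrow> nat \<Rightarrow> vec3 \<Rightarrow> vec3 \<Rightarrow> complex" where
  "G_weight m E \<tau> i j k l \<zeta> \<xi> = complex_of_real (1 / (2 * pi) powr (3/2)) *
     (LINT u'|lborel. LINT \<omega>|sphere_measure.
       (let u = sqrt ((norm u')\<^sup>2 + 2 * energy_gap E i j k l / reduced_mass (m i) (m j)) *\<^sub>R \<omega>
        in complex_of_real (norm u' * \<tau> k l i j u' \<omega>)
           * exp (- \<i> * complex_of_real (reduced_mass (m i) (m j) / m i * (\<zeta> \<bullet> (u - u'))))
           * exp (- \<i> * complex_of_real (\<xi> \<bullet> u'))))"

definition L_integrand ::
    "(nat \<Rightarrow> nat \<Rightarrow> nat \<Rightarrow> nat \<Rightarrow> cross_section) \<Rightarrow> nat \<Rightarrow> nat \<Rightarrow> nat \<Rightarrow> nat \<Rightarrow>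
     vec3 \<Rightarrow> vec3 \<Rightarrow> vec3 \<Rightarrow> complex" where
  "L_integrand \<tau> i j k l \<xi> u \<omega>' =
     complex_of_real (norm u * \<tau> i j k l u \<omega>') * exp (- \<i> * complex_of_real (\<xi> \<bullet> u))"

definition L_weight ::
    "(nat \<Rightarrow> nat \<Rightarrow> nat \<Rightarrow> nat \<Rightarrow> cross_section) \<Rightarrow> nat \<Rightarrow> nat \<Rightarrow> nat \<Rightarrow> nat \<Rightarrow>
     vec3 \<Rightarrow> complex" where
  "L_weight \<tau> i j k l \<xi> = complex_of_real (1 / (2 * pi) powr (3/2)) *
     (LINT u|lborel. LINT \<omega>'|sphere_measure. L_integrand \<tau> i j k l \<xi> u \<omega>')"

end

theory Submission
  imports Defs "HOL-Probability.Characteristic_Functions"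
begin

text \<open>Writing the post-collisional velocity as \<open>v' = v + (\<mu>/m\<^sub>i) (u' - u)\<close>, every collision integral becomes
  an integral of \<open>exp (-\<i> \<zeta>\<cdot>v) f(v) h(w) K(v - w)\<close> with an integrable kernel \<open>K\<close>, that is, of a product of
  \<open>exp (-\<i> \<zeta>\<cdot>v) f(v)\<close> with the convolution of \<open>h\<close> and \<open>K\<close>.  For \<open>f\<close>, \<open>h\<close> integrable and square integrable,
  Parseval's identity turns it into the weighted convolution; it is obtained by inserting the factor
  \<open>exp (-\<epsilon>\<^sup>2 |\<xi>|\<^sup>2 / 2)\<close> and letting \<open>\<epsilon> \<rightarrow> 0\<close>, where the limit uses that translation of \<open>K\<close> is continuous
  in the mean.  Micro-reversibility moves the inelastic gain term to the variables of the inverse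
  collision.  For elastic collisions the gain and loss terms need not converge separately, and the
  change of variables is instead applied to the antisymmetric difference of the two.\<close>

section \<open>Gaussians\<close>

text \<open>The transform of the convolution of \<open>h\<close> and \<open>K\<close> need not be
  integrable on its own, so Fourier inversion cannot be applied to it. What is integrable is the
  whole product: the transforms of \<open>f\<close> and \<open>h\<close> are square integrable and
  that of \<open>K\<close> is bounded. This is the role of square integrability; the bounds in
  velocity space use it as well, through |ab| \<le> a^2 + b^2 in place of Cauchy-Schwarz. In all
  three weights \<xi> enters only through a factor exp (-\<i> \<xi>.u), so each weight is the
  Fourier transform of the angular integral of a kernel independent of \<xi>. One result about such
  kernels therefore serves the elastic, the gain and the loss term, and absolute convergence at
  \<xi> = 0 is absolute convergence at every \<xi>. The gain kernel differs from the loss kernel of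
  the inverse collision by a phase only. In the elastic weight the factor exp[...] - 1 vanishes as
  u' approaches u and can compensate a singularity of the cross-section at grazing collisions. The
  weight may thus converge although the kernels of gain and loss do not.\<close>

lemma nn_integral_lborel_affine:
  fixes t :: "'a::euclidean_space" and c :: real
  assumes [measurable]: "g \<in> borel_measurable borel" and c: "c \<noteq> 0"
  shows "(\<integral>\<^sup>+x. g x \<partial>lborel) = \<bar>c\<bar> ^ DIM('a) * (\<integral>\<^sup>+x. g (t + c *\<^sub>R x) \<partial>lborel)"
  by (subst lborel_affine[OF c, of t])
     (simp add: nn_integral_density nn_integral_distr nn_integral_cmult ennreal_power)

lemma integrable_lborel_affine:
  fixes g :: "'a::euclidean_space \<Rightarrow> 'b::{banach, second_countable_topology}" and c :: real
  assumes g: "integrable lborel g" and c: "c \<noteq> 0"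
  shows "integrable lborel (\<lambda>x. g (t + c *\<^sub>R x))"
proof -
  have [measurable]: "g \<in> borel_measurable borel"
    using borel_measurable_integrable[OF g] by simp
  have "integrable (density (distr lborel borel (\<lambda>x. t + c *\<^sub>R x)) (\<lambda>_. \<bar>c\<bar> ^ DIM('a))) g"
    using g by (subst (asm) lborel_affine[OF c, of t])
  then show ?thesis
    using c integrable_scaleR_right[of "inverse (\<bar>c\<bar> ^ DIM('a))" lborel "\<lambda>x. \<bar>c\<bar> ^ DIM('a) *\<^sub>R g (t + c *\<^sub>R x)"]
    by (subst (asm) integrable_density) (simp_all add: integrable_distr_eq)
qed

lemma integral_lborel_affine:
  fixes g :: "'a::euclidean_space \<Rightarrow> 'b::{banach, second_countable_topology}" and c :: real
  assumes [measurable]: "g \<in> borel_measurable borel" and c: "c \<noteq> 0"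
  shows "(LINT x|lborel. g x) = \<bar>c\<bar> ^ DIM('a) *\<^sub>R (LINT x|lborel. g (t + c *\<^sub>R x))"
  by (subst lborel_affine[OF c, of t])
     (simp add: integral_density integral_distr)

text \<open>Unnormalised, with value 1 at the origin:
  \<open>gaussian (\<epsilon> *\<^sub>R \<xi>)\<close> never exceeds 1 and tends to 1 as \<epsilon>
  tends to 0, as a regularising factor should. With this width it is an eigenfunction of the Fourier
  transform.\<close>

definition gaussian :: "'a::euclidean_space \<Rightarrow> real" where
  "gaussian x = exp (- (norm x)\<^sup>2 / 2)"

lemma gaussian_pos: "gaussian x > 0" and gaussian_le_1: "gaussian x \<le> 1"
  and gaussian_0 [simp]: "gaussian 0 = 1"
  by (simp_all add: gaussian_def)

lemma borel_measurable_gaussian [measurable]: "gaussian \<in> borel_measurable borel"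
  unfolding gaussian_def[abs_def] by measurable

text \<open>This is the characteristic function of the standard normal distribution, multiplied by
  \<open>sqrt (2 * pi)\<close> to undo the normalisation of the density.\<close>

lemma gaussian_fourier_real:
  fixes t :: real
  shows "integrable lborel (\<lambda>x. exp (\<i> * complex_of_real (t * x)) * complex_of_real (exp (- x\<^sup>2 / 2)))"
    and "(LINT x|lborel. exp (\<i> * complex_of_real (t * x)) * complex_of_real (exp (- x\<^sup>2 / 2)))
       = complex_of_real (sqrt (2 * pi) * exp (- t\<^sup>2 / 2))"
proof -
  have eq: "exp (\<i> * complex_of_real (t * x)) * complex_of_real (exp (- x\<^sup>2 / 2))
      = complex_of_real (sqrt (2 * pi)) * (std_normal_density x *\<^sub>R iexp (t * x))" for x
    by (simp add: normal_density_def scaleR_conv_of_real)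
  interpret real_distribution std_normal_distribution by (rule real_dist_normal_dist)
  have int: "integrable std_normal_distribution (\<lambda>x. iexp (t * x))"
    by (intro integrable_const_bound[where B=1]) auto
  then have "integrable lborel (\<lambda>x. std_normal_density x *\<^sub>R iexp (t * x))"
    by (subst (asm) integrable_density) auto
  then show "integrable lborel (\<lambda>x. exp (\<i> * complex_of_real (t * x)) * complex_of_real (exp (- x\<^sup>2 / 2)))"
    unfolding eq by (rule integrable_mult_right)
  have "(LINT x|lborel. std_normal_density x *\<^sub>R iexp (t * x)) = char std_normal_distribution t"
    unfolding char_def by (subst integral_density) auto
  then show "(LINT x|lborel. exp (\<i> * complex_of_real (t * x)) * complex_of_real (exp (- x\<^sup>2 / 2)))
       = complex_of_real (sqrt (2 * pi) * exp (- t\<^sup>2 / 2))"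
    unfolding eq integral_mult_right_zero char_std_normal_distribution by simp
qed

text \<open>The integrand factorises into one-dimensional functions \<open>h b\<close> of the
  coordinates, and Lebesgue measure is the image of a product measure, so the integral is a product
  of one-dimensional ones.\<close>

lemma gaussian_fourier:
  fixes x :: "'a::euclidean_space"
  shows "integrable lborel (\<lambda>\<xi>. exp (\<i> * complex_of_real (\<xi> \<bullet> x)) * complex_of_real (gaussian \<xi>))" (is ?int)
    and "(LINT \<xi>|lborel. exp (\<i> * complex_of_real (\<xi> \<bullet> x)) * complex_of_real (gaussian \<xi>))
       = complex_of_real (sqrt (2 * pi) ^ DIM('a) * gaussian x)" (is ?eq)
proof -
  define h where "h b y = exp (\<i> * complex_of_real ((x \<bullet> b) * y)) * complex_of_real (exp (- y\<^sup>2 / 2))"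
    for b :: 'a and y :: real
  have h_int: "integrable lborel (h b)" for b
    using gaussian_fourier_real(1)[of "x \<bullet> b"] by (simp add: h_def[abs_def])
  have [measurable]: "h b \<in> borel_measurable borel" for b
    using borel_measurable_integrable[OF h_int] by simp
  have norm2: "(norm z)\<^sup>2 = (\<Sum>b\<in>Basis. (z \<bullet> b)\<^sup>2)" for z :: 'a
    unfolding power2_norm_eq_inner by (subst euclidean_inner) (simp add: power2_eq_square)
  have eq: "exp (\<i> * complex_of_real (\<xi> \<bullet> x)) * complex_of_real (gaussian \<xi>) = (\<Prod>b\<in>Basis. h b (\<xi> \<bullet> b))"
    for \<xi> :: 'a
  proof -
    have "(\<Prod>b\<in>Basis. h b (\<xi> \<bullet> b))
        = exp (\<Sum>b\<in>Basis. \<i> * complex_of_real ((x \<bullet> b) * (\<xi> \<bullet> b)) + complex_of_real (- (\<xi> \<bullet> b)\<^sup>2 / 2))"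
      unfolding h_def exp_of_real[symmetric] by (simp add: exp_sum mult_exp_exp)
    also have "(\<Sum>b\<in>Basis. \<i> * complex_of_real ((x \<bullet> b) * (\<xi> \<bullet> b)) + complex_of_real (- (\<xi> \<bullet> b)\<^sup>2 / 2))
        = \<i> * complex_of_real (\<xi> \<bullet> x) + complex_of_real (- (norm \<xi>)\<^sup>2 / 2)"
      unfolding sum.distrib norm2 euclidean_inner[of \<xi> x]
      by (simp add: sum_distrib_left sum_negf sum_divide_distrib mult.commute)
    finally show ?thesis
      unfolding gaussian_def exp_of_real[symmetric] by (simp add: mult_exp_exp)
  qed
  interpret product_sigma_finite "\<lambda>_::'a. lborel :: real measure" by standard
  have T: "(\<lambda>f. \<Sum>b\<in>Basis. f b *\<^sub>R b) \<in> (\<Pi>\<^sub>M b\<in>(Basis::'a set). lborel) \<rightarrow>\<^sub>M borel"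
    by measurable
  have inner: "(\<Sum>b\<in>Basis. f b *\<^sub>R b) \<bullet> c = f c" if "c \<in> Basis" for f :: "'a \<Rightarrow> real" and c
    using that by simp
  have m: "(\<lambda>\<xi>. \<Prod>b\<in>Basis. h b (\<xi> \<bullet> b)) \<in> borel_measurable (borel :: 'a measure)"
    by measurable
  have "integrable (\<Pi>\<^sub>M b\<in>(Basis::'a set). lborel) (\<lambda>f. \<Prod>b\<in>Basis. h b (f b))"
    by (intro product_integrable_prod h_int) simp
  then show ?int
    unfolding eq lborel_eq[where 'a='a] integrable_distr_eq[OF T m] by simp
  have "(LINT \<xi>|(lborel :: 'a measure). (\<Prod>b\<in>Basis. h b (\<xi> \<bullet> b)))
      = (LINT f|(\<Pi>\<^sub>M b\<in>(Basis::'a set). lborel). (\<Prod>b\<in>Basis. h b (f b)))"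
    unfolding lborel_eq[where 'a='a] integral_distr[OF T m] by simp
  also have "\<dots> = (\<Prod>b\<in>Basis. LINT y|lborel. h b y)"
    by (intro product_integral_prod h_int) simp
  also have "\<dots> = (\<Prod>b\<in>Basis. complex_of_real (sqrt (2 * pi) * exp (- (x \<bullet> b)\<^sup>2 / 2)))"
    unfolding h_def gaussian_fourier_real(2) ..
  also have "\<dots> = complex_of_real (sqrt (2 * pi) ^ DIM('a) * gaussian x)"
    unfolding gaussian_def norm2 of_real_prod[symmetric]
    by (simp add: prod.distrib sum_negf sum_divide_distrib flip: exp_sum)
  finally show ?eq unfolding eq .
qed

lemma integrable_gaussian: "integrable lborel (gaussian :: 'a::euclidean_space \<Rightarrow> real)"
  and integral_gaussian: "(LINT x|lborel. gaussian (x::'a)) = sqrt (2 * pi) ^ DIM('a)"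
proof -
  have i: "integrable lborel (\<lambda>x::'a. complex_of_real (gaussian x))"
    using gaussian_fourier(1)[of "0::'a"] by simp
  then show "integrable lborel (gaussian :: 'a \<Rightarrow> real)"
    by (auto dest: integrable_Re)
  have "complex_of_real (LINT x|lborel. gaussian (x::'a)) = complex_of_real (sqrt (2 * pi) ^ DIM('a))"
    using gaussian_fourier(2)[of "0::'a"] by simp
  then show "(LINT x|lborel. gaussian (x::'a)) = sqrt (2 * pi) ^ DIM('a)"
    unfolding of_real_eq_iff .
qed

section \<open>The Fourier integral\<close>

lemma borel_measurable_cis [measurable (raw)]:
  "f \<in> borel_measurable M \<Longrightarrow> (\<lambda>x. cis (f x)) \<in> borel_measurable M"
  unfolding cis_conv_exp by measurable

text \<open>In the form \<open>cis\<close> an exponential has norm 1 by simplification, and phases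
  add by \<open>cis_mult\<close>.\<close>

lemma exp_neg_ii: "exp (- \<i> * complex_of_real t) = cis (- t)"
  by (simp add: cis_conv_exp)

lemma integrable_cis_mult_iff:
  assumes [measurable]: "p \<in> borel_measurable M" "F \<in> borel_measurable M"
  shows "integrable M (\<lambda>x. cis (p x) * F x) \<longleftrightarrow> integrable M F"
  unfolding integrable_iff_bounded by (simp add: norm_mult)

lemma integrable_cis_mult:
  assumes [measurable]: "p \<in> borel_measurable M" and F: "integrable M F"
  shows "integrable M (\<lambda>x. cis (p x) * F x)"
  using F by (subst integrable_cis_mult_iff) auto

lemma (in pair_sigma_finite) integrable_product_mult:
  fixes F :: "'a \<Rightarrow> complex" and G :: "'b \<Rightarrow> complex"
  assumes F: "integrable M1 F" and G: "integrable M2 G"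
  shows "integrable (M1 \<Otimes>\<^sub>M M2) (\<lambda>(x, y). F x * G y)"
proof -
  have [measurable]: "F \<in> borel_measurable M1" "G \<in> borel_measurable M2"
    using F G by auto
  show ?thesis
    by (rule Fubini_integrable) (use F G in \<open>auto simp: norm_mult\<close>)
qed

text \<open>For fixed \<open>v\<close> the argument of \<open>G\<close> is an affine bijection in
  \<open>z\<close>, so the inner integral of the norm of \<open>G\<close> does not depend on
  \<open>v\<close> and Fubini applies. The case \<open>a = 1\<close>,
  \<open>c = - \<epsilon>\<close> serves translations, the case \<open>a = - 1\<close>,
  \<open>c = 1\<close> convolutions.\<close>

lemma integrable_shear:
  fixes F G :: "'a::euclidean_space \<Rightarrow> complex" and a c :: real
  assumes F: "integrable lborel F" and G: "integrable lborel G" and c: "c \<noteq> 0"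
  shows "integrable (lborel \<Otimes>\<^sub>M lborel) (\<lambda>(v, z). F v * G (a *\<^sub>R v + c *\<^sub>R z))"
proof -
  have [measurable]: "F \<in> borel_measurable borel" "G \<in> borel_measurable borel"
    using borel_measurable_integrable[OF F] borel_measurable_integrable[OF G] by simp_all
  have "(LINT z|lborel. norm (G (a *\<^sub>R v + c *\<^sub>R z)))
      = inverse (\<bar>c\<bar> ^ DIM('a)) * (LINT z|lborel. norm (G z))" for v
    using integral_lborel_affine[where c=c and t="a *\<^sub>R v" and g="\<lambda>z. norm (G z)"] c by simp
  then show ?thesis
    using F integrable_lborel_affine[OF G c]
    by (intro lborel_pair.Fubini_integrable) (auto simp: norm_mult)
qed

text \<open>Carries no normalisation and accepts complex integrands, since modulated functions and
  complex kernels have to be transformed too. The powers of 2 pi return with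
  \<open>fourier_eq\<close>.\<close>

definition fourier_integral :: "('a::euclidean_space \<Rightarrow> complex) \<Rightarrow> 'a \<Rightarrow> complex" where
  "fourier_integral F \<xi> = (LINT v|lborel. cis (- (\<xi> \<bullet> v)) * F v)"

lemma borel_measurable_fourier_integral [measurable]:
  assumes [measurable]: "F \<in> borel_measurable borel"
  shows "fourier_integral F \<in> borel_measurable borel"
  unfolding fourier_integral_def[abs_def] by measurable

lemma norm_fourier_integral_le: "norm (fourier_integral F \<xi>) \<le> (LINT v|lborel. norm (F v))"
  using integral_norm_bound[of lborel "\<lambda>v. cis (- (\<xi> \<bullet> v)) * F v"]
  by (simp add: fourier_integral_def norm_mult)

section \<open>Parseval's identity with a Gaussian factor, and the part of Plancherel's theorem that
  follows from it\<close>

text \<open>Spreading over frequencies of order 1/\<epsilon> becomes concentration at scale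
  \<epsilon>: the right-hand side is (2 pi)^d times an approximate identity, where d is the
  dimension.\<close>

lemma scaled_gaussian_fourier:
  fixes x :: "'a::euclidean_space"
  assumes \<epsilon>: "\<epsilon> > 0"
  shows "(LINT \<xi>|lborel. cis (\<xi> \<bullet> x) * complex_of_real (gaussian (\<epsilon> *\<^sub>R \<xi>)))
       = complex_of_real ((sqrt (2 * pi) / \<epsilon>) ^ DIM('a) * gaussian (x /\<^sub>R \<epsilon>))"
proof -
  have "(LINT \<xi>|lborel. cis (\<xi> \<bullet> x) * complex_of_real (gaussian (\<epsilon> *\<^sub>R \<xi>)))
      = inverse \<epsilon> ^ DIM('a) *\<^sub>R
        (LINT \<xi>|lborel. exp (\<i> * complex_of_real (\<xi> \<bullet> (x /\<^sub>R \<epsilon>))) * complex_of_real (gaussian \<xi>))"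
    using \<epsilon> by (subst integral_lborel_affine[where c="inverse \<epsilon>" and t=0]) (simp_all add: cis_conv_exp)
  then show ?thesis
    unfolding gaussian_fourier by (simp add: scaleR_conv_of_real power_divide field_simps)
qed

text \<open>The Gaussian makes the integral over \<xi> and both position variables absolutely
  convergent, so \<xi> can be integrated out inside. This leaves a Gaussian of width \<epsilon> in
  \<open>v - y\<close>. Evaluating the transform of \<open>F\<close> at \<open>- \<xi>\<close>
  rather than conjugating keeps the identity bilinear, as the convolution in Fourier space
  is.\<close>

lemma gaussian_parseval:
  fixes F G :: "'a::euclidean_space \<Rightarrow> complex"
  assumes F: "integrable lborel F" and G: "integrable lborel G" and \<epsilon>: "\<epsilon> > 0"
  shows "(LINT \<xi>|lborel. complex_of_real (gaussian (\<epsilon> *\<^sub>R \<xi>)) *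
            (fourier_integral F (- \<xi>) * fourier_integral G \<xi>))
       = complex_of_real (sqrt (2 * pi) ^ DIM('a)) *
         (LINT z|lborel. complex_of_real (gaussian z) * (LINT v|lborel. F v * G (v - \<epsilon> *\<^sub>R z)))"
proof -
  have [measurable]: "F \<in> borel_measurable borel" "G \<in> borel_measurable borel"
    using borel_measurable_integrable[OF F] borel_measurable_integrable[OF G] by simp_all
  let ?P = "lborel \<Otimes>\<^sub>M lborel :: ('a \<times> 'a) measure"
  interpret P: sigma_finite_measure ?P by (rule sigma_finite_pair_measure) (rule sigma_finite_lborel)+
  interpret Q: pair_sigma_finite "lborel :: 'a measure" ?P ..
  define H where "H = (\<lambda>(v, y). F v * G y)"
  have H: "integrable ?P H"
    unfolding H_def by (rule lborel_pair.integrable_product_mult[OF F G])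
  have [measurable]: "H \<in> borel_measurable ?P" using H by auto
  have gauss: "integrable lborel (\<lambda>\<xi>::'a. complex_of_real (gaussian (\<epsilon> *\<^sub>R \<xi>)))"
    using integrable_lborel_affine[OF integrable_gaussian, of \<epsilon> 0] \<epsilon> by (intro integrable_of_real) simp
  have prod: "fourier_integral F (- \<xi>) * fourier_integral G \<xi> = (LINT p|?P. cis (\<xi> \<bullet> (fst p - snd p)) * H p)"
    for \<xi>
  proof -
    have "integrable ?P (\<lambda>(v, y). (cis (- (- \<xi> \<bullet> v)) * F v) * (cis (- (\<xi> \<bullet> y)) * G y))"
      by (intro lborel_pair.integrable_product_mult integrable_cis_mult F G) measurable
    from lborel_pair.integral_fst'[OF this]
    have "fourier_integral F (- \<xi>) * fourier_integral G \<xi>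
        = (LINT p|?P. (cis (\<xi> \<bullet> fst p) * F (fst p)) * (cis (- (\<xi> \<bullet> snd p)) * G (snd p)))"
      by (simp add: fourier_integral_def case_prod_beta')
    also have "\<dots> = (LINT p|?P. cis (\<xi> \<bullet> (fst p - snd p)) * H p)"
    proof (rule Bochner_Integration.integral_cong[OF refl])
      fix p :: "'a \<times> 'a"
      have "cis (\<xi> \<bullet> (fst p - snd p)) = cis (\<xi> \<bullet> fst p) * cis (- (\<xi> \<bullet> snd p))"
        by (simp add: cis_mult inner_diff_right)
      then show "(cis (\<xi> \<bullet> fst p) * F (fst p)) * (cis (- (\<xi> \<bullet> snd p)) * G (snd p))
          = cis (\<xi> \<bullet> (fst p - snd p)) * H p"
        by (simp only: H_def case_prod_beta mult_ac)
    qed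
    finally show ?thesis .
  qed
  have tot: "integrable (lborel \<Otimes>\<^sub>M ?P)
      (\<lambda>(\<xi>, p). cis (\<xi> \<bullet> (fst p - snd p)) * (complex_of_real (gaussian (\<epsilon> *\<^sub>R \<xi>)) * H p))"
    using integrable_cis_mult[OF _ Q.integrable_product_mult[OF gauss H], of "\<lambda>(\<xi>, p). \<xi> \<bullet> (fst p - snd p)"]
    by (simp add: case_prod_beta')
  \<comment> \<open>Justifies the final exchange of \<open>v\<close> and \<open>z\<close>; the
    Gaussian is at most 1, so the shear alone dominates.\<close>
  have sh: "integrable ?P (\<lambda>(v, z). F v * (complex_of_real (gaussian z) * G (v - \<epsilon> *\<^sub>R z)))"
  proof (rule Bochner_Integration.integrable_bound)
    show "integrable ?P (\<lambda>(v, z). F v * G (1 *\<^sub>R v + (- \<epsilon>) *\<^sub>R z))"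
      by (rule integrable_shear[OF F G]) (use \<epsilon> in simp)
    show "AE p in ?P. norm (case p of (v, z) \<Rightarrow> F v * (complex_of_real (gaussian z) * G (v - \<epsilon> *\<^sub>R z)))
        \<le> norm (case p of (v, z) \<Rightarrow> F v * G (1 *\<^sub>R v + (- \<epsilon>) *\<^sub>R z))"
      by (rule AE_I2)
         (auto simp: norm_mult gaussian_pos less_imp_le gaussian_le_1 intro!: mult_left_mono mult_left_le_one_le)
  qed measurable
  have "(LINT \<xi>|lborel. complex_of_real (gaussian (\<epsilon> *\<^sub>R \<xi>)) *
            (fourier_integral F (- \<xi>) * fourier_integral G \<xi>))
      = (LINT \<xi>|lborel. LINT p|?P. cis (\<xi> \<bullet> (fst p - snd p)) * (complex_of_real (gaussian (\<epsilon> *\<^sub>R \<xi>)) * H p))"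
    unfolding prod integral_mult_right_zero[symmetric] by (simp add: mult_ac)
  also have "\<dots> = (LINT p|?P. LINT \<xi>|lborel. cis (\<xi> \<bullet> (fst p - snd p)) * (complex_of_real (gaussian (\<epsilon> *\<^sub>R \<xi>)) * H p))"
    using Q.Fubini_integral[OF tot] by simp
  also have "\<dots> = (LINT p|?P. (LINT \<xi>|lborel. cis (\<xi> \<bullet> (fst p - snd p)) * complex_of_real (gaussian (\<epsilon> *\<^sub>R \<xi>))) * H p)"
    unfolding mult.assoc[symmetric] integral_mult_left_zero ..
  also have "\<dots> = (LINT p|?P. complex_of_real ((sqrt (2 * pi) / \<epsilon>) ^ DIM('a) * gaussian ((fst p - snd p) /\<^sub>R \<epsilon>)) * H p)"
    unfolding scaled_gaussian_fourier[OF \<epsilon>] ..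
  also have "\<dots> = (LINT v|lborel. LINT y|lborel.
      complex_of_real ((sqrt (2 * pi) / \<epsilon>) ^ DIM('a) * gaussian ((v - y) /\<^sub>R \<epsilon>)) * (F v * G y))"
  proof -
    have "integrable ?P (\<lambda>p. complex_of_real (gaussian ((fst p - snd p) /\<^sub>R \<epsilon>)) * H p)"
      by (rule Bochner_Integration.integrable_bound[OF H])
         (auto simp: norm_mult gaussian_pos less_imp_le gaussian_le_1 intro!: mult_left_le_one_le)
    then have "integrable ?P (\<lambda>p. complex_of_real ((sqrt (2 * pi) / \<epsilon>) ^ DIM('a)) *
        (complex_of_real (gaussian ((fst p - snd p) /\<^sub>R \<epsilon>)) * H p))"
      by (rule integrable_mult_right)
    then have "integrable ?P (\<lambda>p. complex_of_real ((sqrt (2 * pi) / \<epsilon>) ^ DIM('a) * gaussian ((fst p - snd p) /\<^sub>R \<epsilon>)) * H p)"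
      by (simp add: mult.assoc)
    from lborel_pair.integral_fst'[OF this] show ?thesis
      by (simp add: H_def)
  qed
  also have "\<dots> = (LINT v|lborel. LINT z|lborel.
      complex_of_real (sqrt (2 * pi) ^ DIM('a)) * (F v * (complex_of_real (gaussian z) * G (v - \<epsilon> *\<^sub>R z))))"
  proof (rule Bochner_Integration.integral_cong[OF refl])
    fix v :: 'a
    have g: "gaussian (- z) = gaussian z" for z :: 'a by (simp add: gaussian_def)
    let ?g = "\<lambda>y. complex_of_real ((sqrt (2 * pi) / \<epsilon>) ^ DIM('a) * gaussian ((v - y) /\<^sub>R \<epsilon>)) * (F v * G y)"
    \<comment> \<open>Substitution of \<open>v - \<epsilon> *\<^sub>R z\<close> for
      \<open>y\<close>: the Jacobian \<epsilon>^d cancels the factor \<epsilon>^(-d) from the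
      transformed Gaussian.\<close>
    have "(LINT y|lborel. ?g y) = \<bar>- \<epsilon>\<bar> ^ DIM('a) *\<^sub>R (LINT z|lborel. ?g (v + (- \<epsilon>) *\<^sub>R z))"
      using \<epsilon> by (intro integral_lborel_affine) auto
    also have "\<dots> = (LINT z|lborel. \<bar>- \<epsilon>\<bar> ^ DIM('a) *\<^sub>R ?g (v + (- \<epsilon>) *\<^sub>R z))"
      by simp
    also have "\<dots> = (LINT z|lborel. complex_of_real (sqrt (2 * pi) ^ DIM('a)) * (F v * (complex_of_real (gaussian z) * G (v - \<epsilon> *\<^sub>R z))))"
      using \<epsilon> by (intro Bochner_Integration.integral_cong refl)
        (simp add: g scaleR_conv_of_real power_divide)
    finally show "(LINT y|lborel. ?g y) = (LINT z|lborel. complex_of_real (sqrt (2 * pi) ^ DIM('a)) *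
        (F v * (complex_of_real (gaussian z) * G (v - \<epsilon> *\<^sub>R z))))" .
  qed
  also have "\<dots> = complex_of_real (sqrt (2 * pi) ^ DIM('a)) *
      (LINT v|lborel. LINT z|lborel. F v * (complex_of_real (gaussian z) * G (v - \<epsilon> *\<^sub>R z)))"
    by simp
  also have "(LINT v|lborel. LINT z|lborel. F v * (complex_of_real (gaussian z) * G (v - \<epsilon> *\<^sub>R z)))
      = (LINT z|lborel. LINT v|lborel. F v * (complex_of_real (gaussian z) * G (v - \<epsilon> *\<^sub>R z)))"
    using lborel_pair.Fubini_integral[OF sh] by simp
  also have "\<dots> = (LINT z|lborel. complex_of_real (gaussian z) * (LINT v|lborel. F v * G (v - \<epsilon> *\<^sub>R z)))"
    unfolding integral_mult_right_zero[symmetric] by (simp add: mult_ac)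
  finally show ?thesis .
qed

text \<open>Only uniformity in the shift \<open>y\<close> matters, so |ab| \<le> (a^2 + b^2) / 2
  suffices and translation invariance removes \<open>y\<close>. For \<open>h = f\<close> the bound
  is that of Cauchy-Schwarz.\<close>

lemma norm_integral_mult_translate_le:
  fixes f h :: "'a::euclidean_space \<Rightarrow> real" and y :: 'a
  assumes f: "f \<in> borel_measurable borel" "integrable lborel (\<lambda>v. (f v)\<^sup>2)"
    and h: "h \<in> borel_measurable borel" "integrable lborel (\<lambda>v. (h v)\<^sup>2)"
  shows "\<bar>LINT v|lborel. f v * h (v - y)\<bar> \<le> ((LINT v|lborel. (f v)\<^sup>2) + (LINT v|lborel. (h v)\<^sup>2)) / 2"
proof -
  have [measurable]: "f \<in> borel_measurable borel" "h \<in> borel_measurable borel" by fact+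
  have h': "integrable lborel (\<lambda>v. (h (v - y))\<^sup>2)"
    using integrable_lborel_affine[OF h(2), of 1 "- y"] by simp
  have eq: "(LINT v|lborel. (h (v - y))\<^sup>2) = (LINT v|lborel. (h v)\<^sup>2)"
    using integral_lborel_affine[of "\<lambda>v. (h v)\<^sup>2" 1 "- y"] by simp
  have am: "\<bar>a * b\<bar> \<le> (a\<^sup>2 + b\<^sup>2) / 2" for a b :: real
    using sum_squares_bound[of "\<bar>a\<bar>" "\<bar>b\<bar>"] by (simp add: abs_mult)
  have int: "integrable lborel (\<lambda>v. f v * h (v - y))"
    by (rule Bochner_Integration.integrable_bound[of _ "\<lambda>v. ((f v)\<^sup>2 + (h (v - y))\<^sup>2) / 2"])
       (use f h' am in auto)
  have "\<bar>LINT v|lborel. f v * h (v - y)\<bar> \<le> (LINT v|lborel. \<bar>f v * h (v - y)\<bar>)"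
    using integral_norm_bound[of lborel "\<lambda>v. f v * h (v - y)"] by simp
  also have "\<dots> \<le> (LINT v|lborel. ((f v)\<^sup>2 + (h (v - y))\<^sup>2) / 2)"
    by (intro integral_mono) (use int f h' am in auto)
  also have "\<dots> = ((LINT v|lborel. (f v)\<^sup>2) + (LINT v|lborel. (h v)\<^sup>2)) / 2"
    using f h' by (simp add: eq)
  finally show ?thesis .
qed

text \<open>The Gaussian-weighted integrals of the squared modulus are bounded by \<open>C\<close>
  uniformly in \<epsilon>, so Fatou's lemma bounds the unweighted one. This is the inequality in
  Plancherel's theorem.\<close>

lemma square_integrable_fourier_integral:
  fixes f :: "'a::euclidean_space \<Rightarrow> real"
  assumes f: "integrable lborel f" and f2: "integrable lborel (\<lambda>v. (f v)\<^sup>2)"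
  shows "integrable lborel (\<lambda>\<xi>. (norm (fourier_integral (\<lambda>v. complex_of_real (f v)) \<xi>))\<^sup>2)"
proof -
  have [measurable]: "f \<in> borel_measurable borel"
    using borel_measurable_integrable[OF f] by simp
  define A where "A = fourier_integral (\<lambda>v. complex_of_real (f v))"
  have [measurable]: "A \<in> borel_measurable borel"
    unfolding A_def by measurable
  have fc: "integrable lborel (\<lambda>v. complex_of_real (f v))" using f by simp
  \<comment> \<open>As \<open>f\<close> is real, reflection acts on its transform as conjugation;
    the bilinear identity taken with \<open>f\<close> twice therefore yields a squared
    modulus.\<close>
  have "A (- \<xi>) = cnj (A \<xi>)" for \<xi>
    unfolding A_def fourier_integral_def
    by (simp flip: Bochner_Integration.integral_cnj add: cis_cnj)
  then have sq: "A (- \<xi>) * A \<xi> = complex_of_real ((norm (A \<xi>))\<^sup>2)" for \<xi>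
    unfolding complex_norm_square by (simp add: mult.commute)
  define S where "S = (LINT v|lborel. (f v)\<^sup>2)"
  define C where "C = (2 * pi) ^ DIM('a) * S"
  have bound: "(LINT \<xi>|lborel. gaussian (\<epsilon> *\<^sub>R \<xi>) * (norm (A \<xi>))\<^sup>2) \<le> C" if \<epsilon>: "\<epsilon> > 0" for \<epsilon>
  proof -
    have "complex_of_real (LINT \<xi>|lborel. gaussian (\<epsilon> *\<^sub>R \<xi>) * (norm (A \<xi>))\<^sup>2)
        = (LINT \<xi>|lborel. complex_of_real (gaussian (\<epsilon> *\<^sub>R \<xi>)) * (A (- \<xi>) * A \<xi>))"
      unfolding sq by (simp flip: integral_complex_of_real)
    also have "\<dots> = complex_of_real (sqrt (2 * pi) ^ DIM('a)) *
         (LINT z|lborel. complex_of_real (gaussian z) *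
            (LINT v|lborel. complex_of_real (f v) * complex_of_real (f (v - \<epsilon> *\<^sub>R z))))"
      unfolding A_def by (rule gaussian_parseval[OF fc fc \<epsilon>])
    also have "\<dots> = complex_of_real (sqrt (2 * pi) ^ DIM('a) *
         (LINT z|lborel. gaussian z * (LINT v|lborel. f v * f (v - \<epsilon> *\<^sub>R z))))"
      by (simp flip: integral_complex_of_real)
    finally have "(LINT \<xi>|lborel. gaussian (\<epsilon> *\<^sub>R \<xi>) * (norm (A \<xi>))\<^sup>2)
        = sqrt (2 * pi) ^ DIM('a) * (LINT z|lborel. gaussian z * (LINT v|lborel. f v * f (v - \<epsilon> *\<^sub>R z)))"
      unfolding of_real_eq_iff .
    also have "\<dots> \<le> sqrt (2 * pi) ^ DIM('a) * (LINT z|lborel. gaussian (z::'a) * S)"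
    proof (rule mult_left_mono[OF integral_mono_AE'[OF _ AE_I2 AE_I2]])
      fix z :: 'a
      have "\<bar>LINT v|lborel. f v * f (v - \<epsilon> *\<^sub>R z)\<bar> \<le> S"
        using norm_integral_mult_translate_le[of f f "\<epsilon> *\<^sub>R z"] f2 by (simp add: S_def)
      then show "gaussian z * (LINT v|lborel. f v * f (v - \<epsilon> *\<^sub>R z)) \<le> gaussian z * S"
        by (intro mult_left_mono) (auto simp: gaussian_pos less_imp_le)
      show "0 \<le> gaussian z * S"
        by (simp add: S_def gaussian_pos less_imp_le)
    qed (auto intro!: integrable_mult_left integrable_gaussian)
    also have "\<dots> = C"
    proof -
      have "sqrt (2 * pi) ^ DIM('a) * sqrt (2 * pi) ^ DIM('a) = (2 * pi) ^ DIM('a)"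
        by (subst power_mult_distrib[symmetric], subst real_sqrt_mult_self) simp
      then show ?thesis by (simp add: integral_gaussian C_def)
    qed
    finally show ?thesis .
  qed
  \<comment> \<open>For fixed \<epsilon> this is cheap, because \<open>A\<close> is bounded by the
    L1 norm of \<open>f\<close>; it is \<open>bound\<close> that is uniform in \<epsilon>.\<close>
  have int: "integrable lborel (\<lambda>\<xi>::'a. gaussian (\<epsilon> *\<^sub>R \<xi>) * (norm (A \<xi>))\<^sup>2)" if \<epsilon>: "\<epsilon> > 0" for \<epsilon>
  proof (rule Bochner_Integration.integrable_bound)
    show "integrable lborel (\<lambda>\<xi>::'a. gaussian (0 + \<epsilon> *\<^sub>R \<xi>) * (LINT v|lborel. norm (f v))\<^sup>2)"
      using \<epsilon> by (intro integrable_mult_left integrable_lborel_affine integrable_gaussian) simp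
    show "AE \<xi>::'a in lborel. norm (gaussian (\<epsilon> *\<^sub>R \<xi>) * (norm (A \<xi>))\<^sup>2)
        \<le> norm (gaussian (0 + \<epsilon> *\<^sub>R \<xi>) * (LINT v|lborel. norm (f v))\<^sup>2)"
      using norm_fourier_integral_le[of "\<lambda>v. complex_of_real (f v)"]
      by (intro AE_I2) (auto simp: A_def abs_mult intro!: mult_left_mono power_mono)
  qed measurable
  define e where "e n = inverse (real (Suc n))" for n
  have e: "e n > 0" "e \<longlonglongrightarrow> 0" for n
    using LIMSEQ_inverse_real_of_nat by (auto simp: e_def[abs_def])
  have lim: "(\<lambda>n. gaussian (e n *\<^sub>R \<xi>) * (norm (A \<xi>))\<^sup>2) \<longlonglongrightarrow> (norm (A \<xi>))\<^sup>2" for \<xi>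
    unfolding gaussian_def by (rule tendsto_eq_intros e(2) refl | simp)+
  \<comment> \<open>Fatou's lemma along the null sequence \<open>e\<close>. Passing on to the limsup
    turns the bound valid for every \<open>n\<close> into a bound for the limit.\<close>
  have "(\<integral>\<^sup>+\<xi>. ennreal ((norm (A \<xi>))\<^sup>2) \<partial>lborel)
      = (\<integral>\<^sup>+\<xi>. liminf (\<lambda>n. ennreal (gaussian (e n *\<^sub>R \<xi>) * (norm (A \<xi>))\<^sup>2)) \<partial>lborel)"
    by (intro nn_integral_cong lim_imp_Liminf[OF sequentially_bot, symmetric] tendsto_ennrealI lim)
  also have "\<dots> \<le> liminf (\<lambda>n. \<integral>\<^sup>+\<xi>. ennreal (gaussian (e n *\<^sub>R \<xi>) * (norm (A \<xi>))\<^sup>2) \<partial>lborel)"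
    by (rule nn_integral_liminf) measurable
  also have "\<dots> \<le> limsup (\<lambda>n. \<integral>\<^sup>+\<xi>. ennreal (gaussian (e n *\<^sub>R \<xi>) * (norm (A \<xi>))\<^sup>2) \<partial>lborel)"
    by (rule Liminf_le_Limsup) simp
  also have "\<dots> \<le> ennreal C"
    by (intro Limsup_bounded always_eventually allI, subst nn_integral_eq_integral)
       (auto intro!: int e ennreal_leI bound AE_I2 simp: gaussian_pos less_imp_le)
  also have "\<dots> < \<infinity>" by simp
  finally show ?thesis
    unfolding A_def[symmetric] by (intro integrableI_bounded) auto
qed

section \<open>Continuity of translations\<close>

text \<open>For the indicator of an open set \<open>U\<close> continuity of translations in the mean is dominated
  convergence, since \<open>U\<close> and its translates have the same measure; outer regularity extends it to
  all sets of finite measure.\<close>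

lemma translation_tendsto_L1_open:
  fixes U :: "'a::euclidean_space set"
  assumes U: "open U" "emeasure lborel U < \<infinity>" and y: "y \<longlonglongrightarrow> 0"
  shows "(\<lambda>n. LINT x|lborel. \<bar>indicator U (x - y n) - indicator U x\<bar> :: real) \<longlonglongrightarrow> 0"
proof -
  have [measurable]: "U \<in> sets borel" using U by auto
  have iU: "integrable lborel (indicator U :: 'a \<Rightarrow> real)"
    using U by (simp add: integrable_indicator_iff)
  have iUy: "integrable lborel (\<lambda>x. indicator U (x - c) :: real)" for c :: 'a
    using integrable_lborel_affine[OF iU, of 1 "- c"] by simp
  have eq: "(LINT x|lborel. indicator U (x - c)) = (LINT x|lborel. indicator U x :: real)" for c :: 'a
    using integral_lborel_affine[of "indicator U :: 'a \<Rightarrow> real" 1 "- c"] by simp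
  \<comment> \<open>For a, b in {0, 1} one has |a - b| = (a - b) + 2 b (1 - a), and the first
    summand integrates to 0 by translation invariance. Only the points of \<open>U\<close> whose
    translate leaves \<open>U\<close> remain, and there openness helps.\<close>
  have "(LINT x|lborel. \<bar>indicator U (x - y n) - indicator U x\<bar> :: real)
      = 2 * (LINT x|lborel. indicator U x * (1 - indicator U (x - y n)))" for n
  proof -
    have i: "integrable lborel (\<lambda>x. indicator U x * (1 - indicator U (x - y n)) :: real)"
      by (rule Bochner_Integration.integrable_bound[OF iU]) (auto simp: indicator_def)
    have "(LINT x|lborel. \<bar>indicator U (x - y n) - indicator U x\<bar> :: real)
        = (LINT x|lborel. (indicator U (x - y n) - indicator U x)
            + 2 * (indicator U x * (1 - indicator U (x - y n))))"
      by (rule Bochner_Integration.integral_cong) (auto simp: indicator_def)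
    also have "\<dots> = 2 * (LINT x|lborel. indicator U x * (1 - indicator U (x - y n)))"
      using i iU iUy by (subst Bochner_Integration.integral_add) (auto simp: eq)
    finally show ?thesis .
  qed
  moreover have "(\<lambda>n. LINT x|lborel. indicator U x * (1 - indicator U (x - y n)) :: real)
      \<longlonglongrightarrow> (LINT x|(lborel :: 'a measure). 0)"
  proof (rule integral_dominated_convergence[where w="indicator U"])
    show "AE x in lborel. (\<lambda>n. indicator U x * (1 - indicator U (x - y n)) :: real) \<longlonglongrightarrow> 0"
    proof (rule AE_I2)
      fix x
      show "(\<lambda>n. indicator U x * (1 - indicator U (x - y n)) :: real) \<longlonglongrightarrow> 0"
      proof (cases "x \<in> U")
        case True
        have "(\<lambda>n. x - y n) \<longlonglongrightarrow> x - 0" by (intro tendsto_intros y)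
        then have "eventually (\<lambda>n. x - y n \<in> U) sequentially"
          using topological_tendstoD[of "\<lambda>n. x - y n" x sequentially U] True U(1) by simp
        then have "eventually (\<lambda>n. indicator U x * (1 - indicator U (x - y n)) = (0::real)) sequentially"
          by (rule eventually_mono) simp
        then show ?thesis
          by (rule tendsto_eventually)
      qed simp
    qed
  qed (use iU in \<open>auto simp: indicator_def\<close>)
  ultimately show ?thesis
    using tendsto_mult_right_zero by force
qed

text \<open>The translation difference \<open>D\<close> is subadditive in the function and at most
  twice its L1 norm. The functions with the claimed property are therefore closed under sums and L1
  limits, which reduces the claim to indicators.\<close>

lemma translation_tendsto_L1:
  fixes K :: "'a::euclidean_space \<Rightarrow> complex"
  assumes K: "integrable lborel K" and y: "y \<longlonglongrightarrow> 0"
  shows "(\<lambda>n. LINT x|lborel. norm (K (x - y n) - K x)) \<longlonglongrightarrow> 0"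
proof -
  define D where "D K c = (LINT x|lborel. norm (K (x - c) - K x))" for K :: "'a \<Rightarrow> complex" and c
  have tr: "integrable lborel (\<lambda>x. K (x - c))" if "integrable lborel K" for K :: "'a \<Rightarrow> complex" and c
    using integrable_lborel_affine[OF that, of 1 "- c"] by simp
  have tr_eq: "(LINT x|lborel. norm (K (x - c))) = (LINT x|lborel. norm (K x))"
    if [measurable]: "K \<in> borel_measurable borel" for K :: "'a \<Rightarrow> complex" and c
    using integral_lborel_affine[of "\<lambda>x. norm (K x)" 1 "- c"] by simp
  have D_nonneg: "D K c \<ge> 0" for K c by (simp add: D_def)
  have D_add: "D (\<lambda>x. F x + G x) c \<le> D F c + D G c"
    if F: "integrable lborel F" and G: "integrable lborel G" for F G c
  proof -
    have "D (\<lambda>x. F x + G x) c \<le> (LINT x|lborel. norm (F (x - c) - F x) + norm (G (x - c) - G x))"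
      unfolding D_def using tr[OF F] tr[OF G] F G
      by (intro integral_mono) (auto intro: order_trans[OF _ norm_triangle_ineq] simp: algebra_simps)
    also have "\<dots> = D F c + D G c"
      unfolding D_def using tr[OF F] tr[OF G] F G by (intro Bochner_Integration.integral_add) auto
    finally show ?thesis .
  qed
  have D_le: "D F c \<le> 2 * (LINT x|lborel. norm (F x))" if F: "integrable lborel F" for F c
  proof -
    have [measurable]: "F \<in> borel_measurable borel" using borel_measurable_integrable[OF F] by simp
    have "D F c \<le> (LINT x|lborel. norm (F (x - c)) + norm (F x))"
      unfolding D_def using tr[OF F] F by (intro integral_mono norm_triangle_ineq4) auto
    also have "\<dots> = 2 * (LINT x|lborel. norm (F x))"
      using tr[OF F] F by (subst Bochner_Integration.integral_add) (auto simp: tr_eq)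
    finally show ?thesis .
  qed
  \<comment> \<open>An L1 error of \<open>r / 4\<close> costs at most \<open>r / 2\<close>, since
    both the function and its translate are replaced; the other \<open>r / 2\<close> is left for
    \<open>G\<close>.\<close>
  have approx: "(\<lambda>n. D F (y n)) \<longlonglongrightarrow> 0"
    if F: "integrable lborel F"
      and ap: "\<And>e. e > 0 \<Longrightarrow> \<exists>G. integrable lborel G \<and> (LINT x|lborel. norm (F x - G x)) \<le> e \<and> (\<lambda>n. D G (y n)) \<longlonglongrightarrow> 0"
    for F
  proof (rule LIMSEQ_I)
    fix r :: real assume r: "r > 0"
    then obtain G where G: "integrable lborel G" "(LINT x|lborel. norm (F x - G x)) \<le> r / 4"
        "(\<lambda>n. D G (y n)) \<longlonglongrightarrow> 0"
      using ap[of "r / 4"] by auto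
    obtain n0 where n0: "\<And>n. n \<ge> n0 \<Longrightarrow> norm (D G (y n) - 0) < r / 2"
      using LIMSEQ_D[OF G(3), of "r / 2"] r by auto
    have "norm (D F (y n) - 0) < r" if "n \<ge> n0" for n
    proof -
      have "D F (y n) \<le> D (\<lambda>x. F x - G x) (y n) + D G (y n)"
        using D_add[of "\<lambda>x. F x - G x" G "y n"] F G by simp
      also have "\<dots> \<le> 2 * (r / 4) + D G (y n)"
        using D_le[of "\<lambda>x. F x - G x" "y n"] F G by simp
      also have "\<dots> < r" using n0[OF that] D_nonneg[of G "y n"] by simp
      finally show ?thesis using D_nonneg[of F "y n"] by simp
    qed
    then show "\<exists>n0. \<forall>n\<ge>n0. norm (D F (y n) - 0) < r" by auto
  qed
  have D_scale: "D (\<lambda>x. indicator A x *\<^sub>R c) z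
      = norm c * (LINT x|lborel. \<bar>indicator A (x - z) - indicator A x\<bar>)" for A and c :: complex and z
  proof -
    have "norm (indicator A (x - z) *\<^sub>R c - indicator A x *\<^sub>R c)
        = norm c * \<bar>indicator A (x - z) - indicator A x\<bar>" for x
      by (simp only: scaleR_diff_left[symmetric] norm_scaleR real_norm_def mult.commute)
    then show ?thesis unfolding D_def by simp
  qed
  have "(\<lambda>n. D K (y n)) \<longlonglongrightarrow> 0"
    using K
  proof (induction rule: integrable_induct)
    case (base A c)
    then have [measurable]: "A \<in> sets borel" by simp
    show ?case
    proof (rule approx)
      show "integrable lborel (\<lambda>x. indicator A x *\<^sub>R c)" using base by simp
      fix e :: real assume e: "e > 0"
      \<comment> \<open>The \<open>+ 1\<close> keeps the quotient meaningful for
        \<open>c = 0\<close>. The approximant will be the indicator of an open superset of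
        \<open>A\<close>, again multiplied by \<open>c\<close>.\<close>
      define d where "d = e / (norm c + 1)"
      have d: "d > 0" "d * norm c \<le> e"
        using e by (auto simp: d_def field_simps add_pos_nonneg mult_left_mono)
      obtain U where U: "open U" "A \<subseteq> U" "emeasure lborel (U - A) < ennreal d"
        using outer_regular_lborel[of A d] d by auto
      have "emeasure lborel U = emeasure lborel A + emeasure lborel (U - A)"
        using U plus_emeasure[of A lborel "U - A"] by (simp add: Un_absorb1)
      then have fin: "emeasure lborel U < \<infinity>"
        using base U(3) by (auto simp: less_top[symmetric] dest: order.strict_trans)
      have [measurable]: "U \<in> sets borel" using U by auto
      have lim: "(\<lambda>n. D (\<lambda>x. indicator U x *\<^sub>R c) (y n)) \<longlonglongrightarrow> 0"
        unfolding D_scale by (intro tendsto_mult_right_zero translation_tendsto_L1_open U fin y)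
      have "(LINT x|lborel. norm (indicator A x *\<^sub>R c - indicator U x *\<^sub>R c))
          = (LINT x|lborel. indicator (U - A) x * norm c)"
        using U(2) by (intro Bochner_Integration.integral_cong) (auto simp: indicator_def)
      also have "\<dots> = measure lborel (U - A) * norm c" by simp
      also have "\<dots> \<le> d * norm c"
        using U(3) d by (intro mult_right_mono) (auto simp: measure_def enn2real_leI less_imp_le)
      also have "\<dots> \<le> e" by fact
      finally show "\<exists>G. integrable lborel G \<and> (LINT x|lborel. norm (indicator A x *\<^sub>R c - G x)) \<le> e
          \<and> (\<lambda>n. D G (y n)) \<longlonglongrightarrow> 0"
        using lim fin by (intro exI[of _ "\<lambda>x. indicator U x *\<^sub>R c"]) auto
    qed
  next
    case (add F G)
    show ?case
    proof (rule tendsto_sandwich[where f="\<lambda>_. 0" and h="\<lambda>n. D F (y n) + D G (y n)"])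
      show "(\<lambda>n. D F (y n) + D G (y n)) \<longlonglongrightarrow> 0"
        using tendsto_add[OF add.IH] by simp
    qed (use D_nonneg D_add[OF add.hyps] in auto)
  next
    case (lim F s)
    show ?case
    proof (rule approx)
      show "integrable lborel F" by fact
      fix e :: real assume e: "e > 0"
      have "(\<lambda>n. LINT x|lborel. norm (F x - s n x)) \<longlonglongrightarrow> (LINT x|(lborel :: 'a measure). 0)"
      \<comment> \<open>The induction rule supplies simple functions bounded by twice the norm of
        \<open>F\<close>; hence the factor 3.\<close>
      proof (rule integral_dominated_convergence[where w="\<lambda>x. 3 * norm (F x)"])
        show "AE x in lborel. (\<lambda>n. norm (F x - s n x)) \<longlonglongrightarrow> 0"
        proof (rule AE_I2)
          fix x
          show "(\<lambda>n. norm (F x - s n x)) \<longlonglongrightarrow> 0"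
            using tendsto_norm[OF tendsto_diff[OF tendsto_const lim.hyps(2)], of x "F x"] by simp
        qed
        show "AE x in lborel. norm (norm (F x - s n x)) \<le> 3 * norm (F x)" for n
        proof (rule AE_I2)
          fix x
          show "norm (norm (F x - s n x)) \<le> 3 * norm (F x)"
            using lim.hyps(3)[of x n] norm_triangle_ineq4[of "F x" "s n x"] by simp
        qed
      qed (use lim.hyps(1,4) in auto)
      then have "eventually (\<lambda>n. (LINT x|lborel. norm (F x - s n x)) < e) sequentially"
        using order_tendstoD(2)[OF _ e] by simp
      then obtain n where "(LINT x|lborel. norm (F x - s n x)) < e"
        by (auto simp: eventually_sequentially)
      then show "\<exists>G. integrable lborel G \<and> (LINT x|lborel. norm (F x - G x)) \<le> e \<and> (\<lambda>n. D G (y n)) \<longlonglongrightarrow> 0"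
        using lim.hyps(1) lim.IH by (intro exI[of _ "s n"]) auto
    qed
  qed
  then show ?thesis by (simp add: D_def)
qed

section \<open>Convolution estimates\<close>

text \<open>After |ab| \<le> a^2 + b^2 each summand depends on one of \<open>v\<close>,
  \<open>w\<close> only, and integrating \<open>k (v - w)\<close> over the other gives the full
  integral of \<open>k\<close>. Working in \<open>ennreal\<close> requires no integrability
  beforehand.\<close>

lemma nn_integral_mult_translate_le:
  fixes f h :: "'a::euclidean_space \<Rightarrow> real" and k :: "'a \<Rightarrow> ennreal"
  assumes [measurable]: "f \<in> borel_measurable borel" "h \<in> borel_measurable borel" "k \<in> borel_measurable borel"
  shows "(\<integral>\<^sup>+v. \<integral>\<^sup>+w. ennreal \<bar>f v * h w\<bar> * k (v - w) \<partial>lborel \<partial>lborel)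
    \<le> ((\<integral>\<^sup>+v. ennreal ((f v)\<^sup>2) \<partial>lborel) + (\<integral>\<^sup>+v. ennreal ((h v)\<^sup>2) \<partial>lborel)) * (\<integral>\<^sup>+u. k u \<partial>lborel)"
proof -
  have am: "ennreal \<bar>a * b\<bar> \<le> ennreal (a\<^sup>2) + ennreal (b\<^sup>2)" for a b :: real
  proof -
    have "\<bar>a * b\<bar> \<le> a\<^sup>2 + b\<^sup>2"
      using sum_squares_bound[of "\<bar>a\<bar>" "\<bar>b\<bar>"] abs_ge_zero[of "a * b"]
      unfolding abs_mult power2_abs by linarith
    then show ?thesis by (simp flip: ennreal_plus add: ennreal_leI)
  qed
  have k1: "(\<integral>\<^sup>+w. k (v - w) \<partial>lborel) = (\<integral>\<^sup>+u. k u \<partial>lborel)" for v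
    using nn_integral_lborel_affine[of k "- 1" v] by simp
  have k2: "(\<integral>\<^sup>+v. k (v - w) \<partial>lborel) = (\<integral>\<^sup>+u. k u \<partial>lborel)" for w
    using nn_integral_lborel_affine[of k 1 "- w"] by simp
  have "(\<integral>\<^sup>+v. \<integral>\<^sup>+w. ennreal \<bar>f v * h w\<bar> * k (v - w) \<partial>lborel \<partial>lborel)
      \<le> (\<integral>\<^sup>+v. \<integral>\<^sup>+w. (ennreal ((f v)\<^sup>2) + ennreal ((h w)\<^sup>2)) * k (v - w) \<partial>lborel \<partial>lborel)"
    by (intro nn_integral_mono mult_right_mono am) simp
  also have "\<dots> = (\<integral>\<^sup>+v. (\<integral>\<^sup>+w. ennreal ((f v)\<^sup>2) * k (v - w) \<partial>lborel)
      + (\<integral>\<^sup>+w. ennreal ((h w)\<^sup>2) * k (v - w) \<partial>lborel) \<partial>lborel)"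
    unfolding distrib_right by (intro nn_integral_cong nn_integral_add) measurable
  also have "\<dots> = (\<integral>\<^sup>+v. \<integral>\<^sup>+w. ennreal ((f v)\<^sup>2) * k (v - w) \<partial>lborel \<partial>lborel)
      + (\<integral>\<^sup>+v. \<integral>\<^sup>+w. ennreal ((h w)\<^sup>2) * k (v - w) \<partial>lborel \<partial>lborel)"
    by (rule nn_integral_add) measurable
  also have "(\<integral>\<^sup>+v. \<integral>\<^sup>+w. ennreal ((h w)\<^sup>2) * k (v - w) \<partial>lborel \<partial>lborel)
      = (\<integral>\<^sup>+w. \<integral>\<^sup>+v. ennreal ((h w)\<^sup>2) * k (v - w) \<partial>lborel \<partial>lborel)"
    by (rule lborel_pair.Fubini') measurable
  finally show ?thesis
    by (simp add: nn_integral_cmult nn_integral_multc k1 k2 distrib_right)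
qed

text \<open>The factor \<open>S\<close> will be the sphere. Neither \<open>f\<close> nor
  \<open>h\<close> sees it, so the norm of the kernel can be integrated over \<open>S\<close> before
  the translation bound is applied.\<close>

lemma integrable_mult_translate_product:
  fixes f h :: "'a::euclidean_space \<Rightarrow> real" and \<kappa> :: "'a \<times> 's \<Rightarrow> complex"
  assumes S: "sigma_finite_measure S"
    and f: "f \<in> borel_measurable borel" "integrable lborel (\<lambda>v. (f v)\<^sup>2)"
    and h: "h \<in> borel_measurable borel" "integrable lborel (\<lambda>v. (h v)\<^sup>2)"
    and \<kappa>: "integrable (lborel \<Otimes>\<^sub>M S) \<kappa>"
  shows "integrable (lborel \<Otimes>\<^sub>M (lborel \<Otimes>\<^sub>M S))
    (\<lambda>(v, w, s). complex_of_real (f v * h w) * \<kappa> (v - w, s))"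
proof -
  interpret S: sigma_finite_measure S by fact
  interpret P: sigma_finite_measure "(lborel :: 'a measure) \<Otimes>\<^sub>M S"
    by (rule sigma_finite_pair_measure[OF sigma_finite_lborel S])
  have [measurable]: "f \<in> borel_measurable borel" "h \<in> borel_measurable borel"
    "\<kappa> \<in> borel_measurable (lborel \<Otimes>\<^sub>M S)"
    using f h \<kappa> by auto
  have "sets (borel \<Otimes>\<^sub>M S) = sets (lborel \<Otimes>\<^sub>M S)"
    by (rule sets_pair_measure_cong) simp_all
  then have [measurable]: "\<kappa> \<in> borel_measurable (borel \<Otimes>\<^sub>M S)"
    using \<kappa> by (simp cong: measurable_cong_sets)
  define k where "k u = (\<integral>\<^sup>+s. ennreal (norm (\<kappa> (u, s))) \<partial>S)" for u
  have [measurable]: "k \<in> borel_measurable borel"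
    unfolding k_def[abs_def] by measurable
  have "(\<integral>\<^sup>+p. ennreal (norm (case p of (v, w, s) \<Rightarrow> complex_of_real (f v * h w) * \<kappa> (v - w, s)))
          \<partial>(lborel \<Otimes>\<^sub>M (lborel \<Otimes>\<^sub>M S)))
      = (\<integral>\<^sup>+v. \<integral>\<^sup>+w. \<integral>\<^sup>+s. ennreal \<bar>f v * h w\<bar> * ennreal (norm (\<kappa> (v - w, s))) \<partial>S \<partial>lborel \<partial>lborel)"
    by (simp add: P.nn_integral_fst[symmetric] S.nn_integral_fst[symmetric] norm_mult ennreal_mult abs_mult)
  also have "\<dots> = (\<integral>\<^sup>+v. \<integral>\<^sup>+w. ennreal \<bar>f v * h w\<bar> * k (v - w) \<partial>lborel \<partial>lborel)"
    unfolding k_def by (intro nn_integral_cong nn_integral_cmult) measurable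
  also have "\<dots> \<le> ((\<integral>\<^sup>+v. ennreal ((f v)\<^sup>2) \<partial>lborel) + (\<integral>\<^sup>+v. ennreal ((h v)\<^sup>2) \<partial>lborel)) * (\<integral>\<^sup>+u. k u \<partial>lborel)"
    by (rule nn_integral_mult_translate_le) measurable
  also have "(\<integral>\<^sup>+u. k u \<partial>lborel) = (\<integral>\<^sup>+p. ennreal (norm (\<kappa> p)) \<partial>(lborel \<Otimes>\<^sub>M S))"
    unfolding k_def by (rule S.nn_integral_fst) measurable
  also have "((\<integral>\<^sup>+v. ennreal ((f v)\<^sup>2) \<partial>lborel) + (\<integral>\<^sup>+v. ennreal ((h v)\<^sup>2) \<partial>lborel)) * \<dots> < \<infinity>"
    using f(2) h(2) \<kappa> unfolding integrable_iff_bounded by (simp add: ennreal_mult_less_top)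
  finally show ?thesis
    by (intro integrableI_bounded) measurable
qed

text \<open>Here \<open>F\<close> stands for \<open>f\<close> times a phase. The bound is linear in
  the L1 norm of \<open>K\<close>, so it can also be applied to the difference of \<open>K\<close>
  and a translate of \<open>K\<close>.\<close>

lemma
  fixes f h :: "'a::euclidean_space \<Rightarrow> real" and F K :: "'a \<Rightarrow> complex"
  assumes f: "f \<in> borel_measurable borel" "integrable lborel (\<lambda>v. (f v)\<^sup>2)"
    and h: "h \<in> borel_measurable borel" "integrable lborel (\<lambda>v. (h v)\<^sup>2)"
    and K: "integrable lborel K"
    and F: "F \<in> borel_measurable borel" "\<And>v. norm (F v) = \<bar>f v\<bar>"
  shows integrable_mult_translate:
      "integrable (lborel \<Otimes>\<^sub>M lborel) (\<lambda>(v, w). F v * (complex_of_real (h w) * K (v - w)))"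
    and norm_integral_mult_translate:
      "norm (LINT p|(lborel \<Otimes>\<^sub>M lborel). (case p of (v, w) \<Rightarrow> F v * (complex_of_real (h w) * K (v - w))))
       \<le> ((LINT v|lborel. (f v)\<^sup>2) + (LINT v|lborel. (h v)\<^sup>2)) * (LINT u|lborel. norm (K u))"
proof -
  let ?P = "lborel \<Otimes>\<^sub>M lborel :: ('a \<times> 'a) measure"
  define H where "H = (\<lambda>(v, w). F v * (complex_of_real (h w) * K (v - w)))"
  have [measurable]: "f \<in> borel_measurable borel" "h \<in> borel_measurable borel"
    "F \<in> borel_measurable borel" "K \<in> borel_measurable borel"
    using f h F borel_measurable_integrable[OF K] by auto
  have [measurable]: "H \<in> borel_measurable ?P" unfolding H_def by measurable
  let ?C = "((LINT v|lborel. (f v)\<^sup>2) + (LINT v|lborel. (h v)\<^sup>2)) * (LINT u|lborel. norm (K u))"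
  have "(\<integral>\<^sup>+p. ennreal (norm (H p)) \<partial>?P)
      = (\<integral>\<^sup>+v. \<integral>\<^sup>+w. ennreal \<bar>f v * h w\<bar> * ennreal (norm (K (v - w))) \<partial>lborel \<partial>lborel)"
    by (subst lborel.nn_integral_fst[symmetric], measurable)
       (simp add: H_def norm_mult F(2) abs_mult mult.assoc flip: ennreal_mult)
  also have "\<dots> \<le> ((\<integral>\<^sup>+v. ennreal ((f v)\<^sup>2) \<partial>lborel) + (\<integral>\<^sup>+v. ennreal ((h v)\<^sup>2) \<partial>lborel))
      * (\<integral>\<^sup>+u. ennreal (norm (K u)) \<partial>lborel)"
    by (rule nn_integral_mult_translate_le) measurable
  also have "\<dots> = ennreal ?C"
    using f h K by (simp add: nn_integral_eq_integral flip: ennreal_plus ennreal_mult)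
  finally have le: "(\<integral>\<^sup>+p. ennreal (norm (H p)) \<partial>?P) \<le> ennreal ?C" .
  then show int: "integrable ?P (\<lambda>(v, w). F v * (complex_of_real (h w) * K (v - w)))"
    unfolding H_def[symmetric] by (intro integrableI_bounded) (auto simp: less_top[symmetric] top_unique)
  have "ennreal (norm (LINT p|?P. H p)) \<le> ennreal ?C"
    using integral_norm_bound_ennreal[OF int[folded H_def]] le by (rule order_trans)
  then show "norm (LINT p|?P. (case p of (v, w) \<Rightarrow> F v * (complex_of_real (h w) * K (v - w)))) \<le> ?C"
    unfolding H_def[symmetric] by (subst (asm) ennreal_le_iff) auto
qed

text \<open>Fubini applies by the shear estimate, and the phase at \<open>x\<close> splits into
  those at \<open>w\<close> and at \<open>x - w\<close>.\<close>

lemma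
  fixes H K :: "'a::euclidean_space \<Rightarrow> complex"
  assumes H: "integrable lborel H" and K: "integrable lborel K"
  shows integrable_convolution: "integrable lborel (\<lambda>x. LINT w|lborel. H w * K (x - w))"
    and fourier_integral_convolution:
      "fourier_integral (\<lambda>x. LINT w|lborel. H w * K (x - w)) \<xi> = fourier_integral H \<xi> * fourier_integral K \<xi>"
proof -
  have [measurable]: "H \<in> borel_measurable borel" "K \<in> borel_measurable borel"
    using borel_measurable_integrable[OF H] borel_measurable_integrable[OF K] by auto
  have i: "integrable (lborel \<Otimes>\<^sub>M lborel) (\<lambda>(w, x). H w * K (x - w))"
    using integrable_shear[OF H K, of 1 "- 1"] by simp
  from lborel_pair.integrable_snd[OF i]
  show "integrable lborel (\<lambda>x. LINT w|lborel. H w * K (x - w))" .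
  have i': "integrable (lborel \<Otimes>\<^sub>M lborel) (\<lambda>(w, x). cis (- (\<xi> \<bullet> x)) * (H w * K (x - w)))"
    using integrable_cis_mult[OF _ i, of "\<lambda>(w, x). - (\<xi> \<bullet> x)"] by (simp add: case_prod_beta')
  have "fourier_integral (\<lambda>x. LINT w|lborel. H w * K (x - w)) \<xi>
      = (LINT x|lborel. LINT w|lborel. cis (- (\<xi> \<bullet> x)) * (H w * K (x - w)))"
    unfolding fourier_integral_def by simp
  also have "\<dots> = (LINT w|lborel. LINT x|lborel. cis (- (\<xi> \<bullet> x)) * (H w * K (x - w)))"
    by (rule lborel_pair.Fubini_integral[OF i'])
  also have "\<dots> = (LINT w|lborel. cis (- (\<xi> \<bullet> w)) * H w * fourier_integral K \<xi>)"
  proof (rule Bochner_Integration.integral_cong[OF refl])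
    fix w
    have "(LINT x|lborel. cis (- (\<xi> \<bullet> x)) * (H w * K (x - w)))
        = (LINT x|lborel. cis (- (\<xi> \<bullet> (w + x))) * (H w * K x))"
      using integral_lborel_affine[of "\<lambda>x. cis (- (\<xi> \<bullet> x)) * (H w * K (x - w))" 1 w] by simp
    also have "\<dots> = (LINT x|lborel. cis (- (\<xi> \<bullet> w)) * H w * (cis (- (\<xi> \<bullet> x)) * K x))"
    proof (rule Bochner_Integration.integral_cong[OF refl])
      fix x
      have "cis (- (\<xi> \<bullet> (w + x))) = cis (- (\<xi> \<bullet> w)) * cis (- (\<xi> \<bullet> x))"
        by (simp add: cis_mult inner_add_right)
      then show "cis (- (\<xi> \<bullet> (w + x))) * (H w * K x) = cis (- (\<xi> \<bullet> w)) * H w * (cis (- (\<xi> \<bullet> x)) * K x)"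
        by (simp only: mult_ac)
    qed
    also have "\<dots> = cis (- (\<xi> \<bullet> w)) * H w * fourier_integral K \<xi>"
      by (simp add: fourier_integral_def)
    finally show "(LINT x|lborel. cis (- (\<xi> \<bullet> x)) * (H w * K (x - w)))
        = cis (- (\<xi> \<bullet> w)) * H w * fourier_integral K \<xi>" .
  qed
  also have "\<dots> = fourier_integral H \<xi> * fourier_integral K \<xi>"
    by (simp add: fourier_integral_def)
  finally show "fourier_integral (\<lambda>x. LINT w|lborel. H w * K (x - w)) \<xi>
      = fourier_integral H \<xi> * fourier_integral K \<xi>" .
qed

section \<open>Weighted convolutions\<close>

lemma
  fixes f h :: "'a::euclidean_space \<Rightarrow> real" and K :: "'a \<Rightarrow> complex" and \<zeta> :: 'a
  assumes f: "integrable lborel f" "integrable lborel (\<lambda>v. (f v)\<^sup>2)"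
    and h: "integrable lborel h" "integrable lborel (\<lambda>v. (h v)\<^sup>2)"
    and K: "integrable lborel K"
  defines "A \<equiv> fourier_integral (\<lambda>v. complex_of_real (f v))"
    and "B \<equiv> fourier_integral (\<lambda>v. complex_of_real (h v))"
  shows integrable_weighted_convolution:
      "integrable lborel (\<lambda>\<xi>. A (\<zeta> - \<xi>) * B \<xi> * fourier_integral K \<xi>)" (is ?int)
    and integral_weighted_convolution:
      "(LINT \<xi>|lborel. A (\<zeta> - \<xi>) * B \<xi> * fourier_integral K \<xi>)
       = complex_of_real ((2 * pi) ^ DIM('a)) *
         (LINT p|(lborel \<Otimes>\<^sub>M lborel). (case p of (v, w) \<Rightarrow>
            cis (- (\<zeta> \<bullet> v)) * complex_of_real (f v) * (complex_of_real (h w) * K (v - w))))" (is ?eq)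
proof -
  let ?P = "lborel \<Otimes>\<^sub>M lborel :: ('a \<times> 'a) measure"
  have [measurable]: "f \<in> borel_measurable borel" "h \<in> borel_measurable borel" "K \<in> borel_measurable borel"
    using borel_measurable_integrable[OF f(1)] borel_measurable_integrable[OF h(1)]
      borel_measurable_integrable[OF K] by simp_all
  have [measurable]: "A \<in> borel_measurable borel" "B \<in> borel_measurable borel"
    unfolding A_def B_def by measurable
  define F where "F v = cis (- (\<zeta> \<bullet> v)) * complex_of_real (f v)" for v
  define G where "G x = (LINT w|lborel. complex_of_real (h w) * K (x - w))" for x
  have F: "integrable lborel F"
    unfolding F_def[abs_def] using f by (intro integrable_cis_mult integrable_of_real) auto
  have hc: "integrable lborel (\<lambda>v. complex_of_real (h v))"
    using h by (intro integrable_of_real)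
  have G: "integrable lborel G"
    unfolding G_def[abs_def] by (rule integrable_convolution[OF hc K])
  have [measurable]: "F \<in> borel_measurable borel" "G \<in> borel_measurable borel"
    using borel_measurable_integrable[OF F] borel_measurable_integrable[OF G] by simp_all
  have norm_F: "norm (F v) = \<bar>f v\<bar>" for v by (simp add: F_def norm_mult)
  \<comment> \<open>Modulation of \<open>f\<close> becomes translation of its transform; this is the
    origin of the argument \<open>\<zeta> - \<xi>\<close>.\<close>
  have FA: "fourier_integral F (- \<xi>) = A (\<zeta> - \<xi>)" for \<xi>
    unfolding fourier_integral_def A_def F_def
    by (intro Bochner_Integration.integral_cong refl)
       (simp add: mult.assoc[symmetric] cis_mult inner_diff_left)
  have GB: "fourier_integral G \<xi> = B \<xi> * fourier_integral K \<xi>" for \<xi>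
    unfolding G_def[abs_def] B_def by (rule fourier_integral_convolution[OF hc K])

  have A2: "integrable lborel (\<lambda>\<xi>. (norm (A (\<zeta> - \<xi>)))\<^sup>2)"
    using integrable_lborel_affine[OF square_integrable_fourier_integral[OF f], of "- 1" \<zeta>]
    by (simp add: A_def)
  have B2: "integrable lborel (\<lambda>\<xi>. (norm (B \<xi>))\<^sup>2)"
    unfolding B_def by (rule square_integrable_fourier_integral[OF h])
  show int: ?int
  proof (rule Bochner_Integration.integrable_bound)
    show "integrable lborel (\<lambda>\<xi>. ((norm (A (\<zeta> - \<xi>)))\<^sup>2 + (norm (B \<xi>))\<^sup>2) * (LINT u|lborel. norm (K u)))"
      by (intro integrable_mult_left Bochner_Integration.integrable_add A2 B2)
    show "AE \<xi> in lborel. norm (A (\<zeta> - \<xi>) * B \<xi> * fourier_integral K \<xi>)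
        \<le> norm (((norm (A (\<zeta> - \<xi>)))\<^sup>2 + (norm (B \<xi>))\<^sup>2) * (LINT u|lborel. norm (K u)))"
    proof (rule AE_I2)
      fix \<xi>
      have "2 * (norm (A (\<zeta> - \<xi>)) * norm (B \<xi>)) \<le> (norm (A (\<zeta> - \<xi>)))\<^sup>2 + (norm (B \<xi>))\<^sup>2"
        using sum_squares_bound[of "norm (A (\<zeta> - \<xi>))" "norm (B \<xi>)"] by (simp add: mult.assoc)
      moreover have "0 \<le> norm (A (\<zeta> - \<xi>)) * norm (B \<xi>)" by simp
      ultimately have "norm (A (\<zeta> - \<xi>)) * norm (B \<xi>) \<le> (norm (A (\<zeta> - \<xi>)))\<^sup>2 + (norm (B \<xi>))\<^sup>2"
        by linarith
      then have "norm (A (\<zeta> - \<xi>)) * norm (B \<xi>) * norm (fourier_integral K \<xi>)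
          \<le> ((norm (A (\<zeta> - \<xi>)))\<^sup>2 + (norm (B \<xi>))\<^sup>2) * (LINT u|lborel. norm (K u))"
        by (intro mult_mono norm_fourier_integral_le) auto
      then show "norm (A (\<zeta> - \<xi>) * B \<xi> * fourier_integral K \<xi>)
          \<le> norm (((norm (A (\<zeta> - \<xi>)))\<^sup>2 + (norm (B \<xi>))\<^sup>2) * (LINT u|lborel. norm (K u)))"
        by (simp add: norm_mult)
    qed
  qed measurable

  \<comment> \<open>\<open>\<Phi> y\<close> pairs \<open>F\<close> with \<open>G\<close> translated
    by \<open>y\<close>, and \<open>\<Phi> 0\<close> is the integral on the right-hand side. As
    \<open>G\<close> is a convolution, the translation can be shifted onto \<open>K\<close> alone,
    where continuity in the mean is available.\<close>
  define \<Phi> where "\<Phi> y = (LINT v|lborel. F v * G (v - y))" for y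
  define S where "S = (LINT v|lborel. (f v)\<^sup>2) + (LINT v|lborel. (h v)\<^sup>2)"
  have Ky: "integrable lborel (\<lambda>u. K (u - y))" for y
    using integrable_lborel_affine[OF K, of 1 "- y"] by simp
  note tr = integrable_mult_translate[of f h _ F] norm_integral_mult_translate[of f h _ F]
  have \<Phi>_int: "integrable ?P (\<lambda>(v, w). F v * (complex_of_real (h w) * K (v - w - y)))" for y
    using tr(1)[OF _ f(2) _ h(2) Ky[of y] _ norm_F] by simp
  have \<Phi>_eq: "\<Phi> y = (LINT p|?P. (case p of (v, w) \<Rightarrow> F v * (complex_of_real (h w) * K (v - w - y))))" for y
    unfolding \<Phi>_def G_def lborel_pair.integral_fst[OF \<Phi>_int, symmetric]
    by (simp add: algebra_simps)
  have \<Phi>_diff: "norm (\<Phi> y - \<Phi> 0) \<le> S * (LINT u|lborel. norm (K (u - y) - K u))" for y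
  proof -
    have "\<Phi> y - \<Phi> 0 = (LINT p|?P. (case p of (v, w) \<Rightarrow> F v * (complex_of_real (h w) * (K (v - w - y) - K (v - w)))))"
      using \<Phi>_int[of y] \<Phi>_int[of 0] unfolding \<Phi>_eq
      by (subst Bochner_Integration.integral_diff[symmetric])
         (auto intro!: Bochner_Integration.integral_cong simp: right_diff_distrib)
    then show ?thesis
      using tr(2)[OF _ f(2) _ h(2) Bochner_Integration.integrable_diff[OF Ky[of y] K] _ norm_F]
      by (simp add: S_def)
  qed
  have \<Phi>_bound: "norm (\<Phi> y) \<le> S * (LINT u|lborel. norm (K u))" for y
  proof -
    have "(LINT u|lborel. norm (K (u - y))) = (LINT u|lborel. norm (K u))"
      using integral_lborel_affine[of "\<lambda>u. norm (K u)" 1 "- y"] by simp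
    then show ?thesis
      using tr(2)[OF _ f(2) _ h(2) Ky[of y] _ norm_F] by (simp add: \<Phi>_eq S_def)
  qed

  define e where "e n = inverse (real (Suc n))" for n
  have e: "e n > 0" "e \<longlonglongrightarrow> 0" for n
    using LIMSEQ_inverse_real_of_nat by (auto simp: e_def[abs_def])
  \<comment> \<open>The regularised integral has two limits to compare. In Fourier space it is
    dominated by the unregularised integrand; in velocity space it is a Gaussian average of
    \<open>\<Phi> (e n *\<^sub>R z)\<close>, which tends to \<open>\<Phi> 0\<close>
    boundedly.\<close>
  define J where "J n = (LINT \<xi>|lborel. complex_of_real (gaussian (e n *\<^sub>R \<xi>)) *
      (fourier_integral F (- \<xi>) * fourier_integral G \<xi>))" for n
  have J_eq: "J n = complex_of_real (sqrt (2 * pi) ^ DIM('a)) *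
      (LINT z|lborel. complex_of_real (gaussian z) * \<Phi> (e n *\<^sub>R z))" for n
    unfolding J_def \<Phi>_def by (rule gaussian_parseval[OF F G e(1)])
  have "J \<longlonglongrightarrow> (LINT \<xi>|lborel. A (\<zeta> - \<xi>) * B \<xi> * fourier_integral K \<xi>)"
    unfolding J_def[abs_def] FA GB
  proof (rule integral_dominated_convergence)
    show "integrable lborel (\<lambda>\<xi>. norm (A (\<zeta> - \<xi>) * B \<xi> * fourier_integral K \<xi>))"
      using int by (rule integrable_norm)
    show "AE \<xi> in lborel. (\<lambda>n. complex_of_real (gaussian (e n *\<^sub>R \<xi>)) * (A (\<zeta> - \<xi>) * (B \<xi> * fourier_integral K \<xi>)))
        \<longlonglongrightarrow> A (\<zeta> - \<xi>) * B \<xi> * fourier_integral K \<xi>"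
    proof (rule AE_I2)
      fix \<xi> :: 'a
      have "(\<lambda>n. gaussian (e n *\<^sub>R \<xi>)) \<longlonglongrightarrow> 1"
        unfolding gaussian_def by (rule tendsto_eq_intros e(2) refl | simp)+
      from tendsto_mult[OF tendsto_of_real[OF this] tendsto_const]
      show "(\<lambda>n. complex_of_real (gaussian (e n *\<^sub>R \<xi>)) * (A (\<zeta> - \<xi>) * (B \<xi> * fourier_integral K \<xi>)))
        \<longlonglongrightarrow> A (\<zeta> - \<xi>) * B \<xi> * fourier_integral K \<xi>"
        by (simp add: mult.assoc)
    qed
    show "AE \<xi> in lborel. norm (complex_of_real (gaussian (e n *\<^sub>R \<xi>)) * (A (\<zeta> - \<xi>) * (B \<xi> * fourier_integral K \<xi>)))
        \<le> norm (A (\<zeta> - \<xi>) * B \<xi> * fourier_integral K \<xi>)" for n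
      by (rule AE_I2)
         (auto simp: norm_mult mult.assoc gaussian_pos less_imp_le gaussian_le_1 intro!: mult_left_le_one_le)
  qed measurable
  moreover have "J \<longlonglongrightarrow> complex_of_real (sqrt (2 * pi) ^ DIM('a)) *
      (LINT z|lborel. complex_of_real (gaussian (z::'a)) * \<Phi> 0)"
    unfolding J_eq[abs_def]
  proof (rule tendsto_mult[OF tendsto_const], rule integral_dominated_convergence)
    show "integrable lborel (\<lambda>z::'a. gaussian z * (S * (LINT u|lborel. norm (K u))))"
      by (intro integrable_mult_left integrable_gaussian)
    show "AE z::'a in lborel. (\<lambda>n. complex_of_real (gaussian z) * \<Phi> (e n *\<^sub>R z))
        \<longlonglongrightarrow> complex_of_real (gaussian z) * \<Phi> 0"
    proof (rule AE_I2)
      fix z :: 'a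
      have "(\<lambda>n. e n *\<^sub>R z) \<longlonglongrightarrow> 0"
        using tendsto_scaleR[OF e(2) tendsto_const, of z] by simp
      from tendsto_mult_right_zero[OF translation_tendsto_L1[OF K this], of S]
      have "(\<lambda>n. S * (LINT u|lborel. norm (K (u - e n *\<^sub>R z) - K u))) \<longlonglongrightarrow> 0" .
      then have "(\<lambda>n. \<Phi> (e n *\<^sub>R z) - \<Phi> 0) \<longlonglongrightarrow> 0"
        by (rule Lim_null_comparison[OF always_eventually, rotated]) (simp add: \<Phi>_diff)
      then have "(\<lambda>n. \<Phi> (e n *\<^sub>R z)) \<longlonglongrightarrow> \<Phi> 0"
        by (simp add: LIM_zero_iff)
      then show "(\<lambda>n. complex_of_real (gaussian z) * \<Phi> (e n *\<^sub>R z)) \<longlonglongrightarrow> complex_of_real (gaussian z) * \<Phi> 0"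
        by (intro tendsto_mult tendsto_const)
    qed
    show "AE z::'a in lborel. norm (complex_of_real (gaussian z) * \<Phi> (e n *\<^sub>R z))
        \<le> gaussian z * (S * (LINT u|lborel. norm (K u)))" for n
      by (rule AE_I2) (auto simp: norm_mult gaussian_pos less_imp_le intro!: mult_left_mono \<Phi>_bound)
    show "(\<lambda>z. complex_of_real (gaussian z) * \<Phi> (e n *\<^sub>R z)) \<in> borel_measurable lborel" for n
      unfolding \<Phi>_def[abs_def] by measurable
  qed measurable
  ultimately have "(LINT \<xi>|lborel. A (\<zeta> - \<xi>) * B \<xi> * fourier_integral K \<xi>)
      = complex_of_real (sqrt (2 * pi) ^ DIM('a)) * (LINT z|lborel. complex_of_real (gaussian (z::'a)) * \<Phi> 0)"
    by (rule LIMSEQ_unique)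
  \<comment> \<open>One factor comes from the regularised identity, the other is the integral of the
    Gaussian.\<close>
  also have "\<dots> = complex_of_real (sqrt (2 * pi) ^ DIM('a) * sqrt (2 * pi) ^ DIM('a)) * \<Phi> 0"
    by (simp add: integral_gaussian)
  also have "sqrt (2 * pi) ^ DIM('a) * sqrt (2 * pi) ^ DIM('a) = (2 * pi) ^ DIM('a)"
    by (subst power_mult_distrib[symmetric], subst real_sqrt_mult_self) simp
  finally show ?eq
    unfolding \<Phi>_eq F_def by simp
qed

section \<open>Integration over collisions\<close>

interpretation sphere_measure: finite_measure sphere_measure
  by standard (simp add: emeasure_sphere_measure)

interpretation lborel_sphere: pair_sigma_finite "lborel :: vec3 measure" sphere_measure ..

interpretation lborel_sphere_sigma_finite: sigma_finite_measure "(lborel :: vec3 measure) \<Otimes>\<^sub>M sphere_measure"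
  by (rule sigma_finite_pair_measure[OF sigma_finite_lborel sphere_measure.sigma_finite_measure_axioms])

interpretation collision: pair_sigma_finite "lborel :: vec3 measure" "(lborel :: vec3 measure) \<Otimes>\<^sub>M sphere_measure" ..

lemma sets_collision_space [measurable_cong]:
  "sets collision_space = sets (borel \<Otimes>\<^sub>M (borel \<Otimes>\<^sub>M borel))"
  unfolding collision_space_def by (intro sets_pair_measure_cong) simp_all

lemma borel_measurable_sgn [measurable]: "(sgn :: vec3 \<Rightarrow> vec3) \<in> borel_measurable borel"
  unfolding sgn_div_norm[abs_def] by measurable

lemma AE_collision_space: "AE (v, w, \<omega>) in collision_space. \<omega> \<in> sphere 0 1"
proof -
  have [measurable]: "sphere (0::vec3) 1 \<in> sets borel" by (simp add: borel_closed)
  have 1: "AE p in (lborel :: vec3 measure) \<Otimes>\<^sub>M sphere_measure. snd p \<in> sphere 0 1"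
    by (rule lborel_sphere.AE_pair_measure, measurable) (use AE_sphere_measure in simp)
  have "AE p in collision_space. snd (snd p) \<in> sphere 0 1"
    unfolding collision_space_def by (rule collision.AE_pair_measure, measurable) (use 1 in simp)
  then show ?thesis by (simp add: case_prod_beta')
qed

lemma integral_collision_space:
  fixes H :: "vec3 \<times> vec3 \<times> vec3 \<Rightarrow> 'b::{banach, second_countable_topology}"
  assumes H: "integrable collision_space H"
  shows "integral\<^sup>L collision_space H = (LINT v|lborel. LINT w|lborel. LINT \<omega>|sphere_measure. H (v, w, \<omega>))"
proof -
  note H' = H[unfolded collision_space_def]
  have [measurable]: "H \<in> borel_measurable (borel \<Otimes>\<^sub>M (borel \<Otimes>\<^sub>M borel))"
    using borel_measurable_integrable[OF H] by simp
  have "integral\<^sup>L collision_space H = (LINT v|lborel. integral\<^sup>L (lborel \<Otimes>\<^sub>M sphere_measure) (\<lambda>y. H (v, y)))"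
    unfolding collision_space_def by (rule collision.integral_fst'[OF H', symmetric])
  also have "\<dots> = (LINT v|lborel. LINT w|lborel. LINT \<omega>|sphere_measure. H (v, w, \<omega>))"
  \<comment> \<open>The sections at fixed \<open>v\<close> are integrable only for almost every
    \<open>v\<close>.\<close>
  proof (rule integral_cong_AE)
    show "AE v in lborel. integral\<^sup>L (lborel \<Otimes>\<^sub>M sphere_measure) (\<lambda>y. H (v, y))
        = (LINT w|lborel. LINT \<omega>|sphere_measure. H (v, w, \<omega>))"
      using collision.AE_integrable_fst'[OF H']
    proof eventually_elim
      case (elim v)
      from lborel_sphere.integral_fst'[OF elim] show ?case by simp
    qed
  qed measurable
  finally show ?thesis .
qed

section \<open>Fourier transforms of integrals over the collision space\<close>

lemma fourier_eq: "fourier f \<zeta> =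
    complex_of_real ((2 * pi) powr (-3/2)) * fourier_integral (\<lambda>v. complex_of_real (f v)) \<zeta>"
  unfolding fourier_def fourier_integral_def exp_neg_ii ..

lemma fourier_collision_integral:
  assumes q: "integrable collision_space q"
  shows "fourier (\<lambda>v. LINT w|lborel. LINT \<omega>|sphere_measure. q (v, w, \<omega>)) \<zeta>
    = complex_of_real ((2 * pi) powr (-3/2)) *
      (LINT p|collision_space. cis (- (\<zeta> \<bullet> fst p)) * complex_of_real (q p))"
proof -
  have "integrable collision_space (\<lambda>p. cis (- (\<zeta> \<bullet> fst p)) * complex_of_real (q p))"
    using q by (intro integrable_cis_mult integrable_of_real) auto
  from integral_collision_space[OF this] show ?thesis
    unfolding fourier_eq fourier_integral_def by (simp flip: integral_complex_of_real)
qed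

text \<open>\<open>X\<close> is the common shape of the three weights, with everything independent
  of \<xi> collected in \<open>\<kappa>\<close>. Integrating \<open>\<kappa>\<close> over the sphere
  reduces the claim to the weighted convolution with kernel \<open>K\<close>. Of the three
  normalisations (2 pi)^(-3/2), carried by the two transforms and the weight, two are absorbed by
  the (2 pi)^3 of Parseval's identity; the third is that of the transformed collision
  operator.\<close>

lemma
  fixes f h :: "vec3 \<Rightarrow> real" and \<kappa> :: "vec3 \<times> vec3 \<Rightarrow> complex" and \<zeta> :: vec3
  assumes f: "integrable lborel f" "integrable lborel (\<lambda>v. (f v)\<^sup>2)"
    and h: "integrable lborel h" "integrable lborel (\<lambda>v. (h v)\<^sup>2)"
    and \<kappa>: "integrable (lborel \<Otimes>\<^sub>M sphere_measure) \<kappa>"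
  defines "X \<equiv> \<lambda>\<xi>. complex_of_real (1 / (2 * pi) powr (3/2)) *
      (LINT u|lborel. LINT \<omega>|sphere_measure. \<kappa> (u, \<omega>) * cis (- (\<xi> \<bullet> u)))"
  shows integrable_collision_kernel:
      "integrable collision_space
        (\<lambda>(v, w, \<omega>). cis (- (\<zeta> \<bullet> v)) * (complex_of_real (f v * h w) * \<kappa> (v - w, \<omega>)))" (is ?int1)
    and integrable_fourier_convolution:
      "integrable lborel (\<lambda>\<xi>. fourier f (\<zeta> - \<xi>) * fourier h \<xi> * X \<xi>)" (is ?int2)
    and integral_fourier_convolution:
      "(LINT \<xi>|lborel. fourier f (\<zeta> - \<xi>) * fourier h \<xi> * X \<xi>)
       = complex_of_real ((2 * pi) powr (-3/2)) * (LINT p|collision_space.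
          (case p of (v, w, \<omega>) \<Rightarrow> cis (- (\<zeta> \<bullet> v)) * (complex_of_real (f v * h w) * \<kappa> (v - w, \<omega>))))" (is ?eq)
proof -
  have [measurable]: "f \<in> borel_measurable borel" "h \<in> borel_measurable borel"
    using borel_measurable_integrable[OF f(1)] borel_measurable_integrable[OF h(1)] by simp_all
  define K where "K u = (LINT \<omega>|sphere_measure. \<kappa> (u, \<omega>))" for u
  have K: "integrable lborel K"
    unfolding K_def[abs_def] by (rule lborel_sphere.integrable_fst'[OF \<kappa>])
  define c where "c = (2 * pi) powr (-3/2 :: real)"
  have c: "1 / (2 * pi) powr (3/2) = c"
    by (simp add: c_def powr_minus_divide)
  have c2: "c * c * (2 * pi) ^ 3 = 1"
  proof -
    have "c * c = (2 * pi) powr (- 3)" by (simp add: c_def flip: powr_add)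
    then show ?thesis by (simp only: powr_minus) (simp add: powr_numeral field_simps)
  qed
  have X: "X \<xi> = complex_of_real c * fourier_integral K \<xi>" for \<xi>
    unfolding X_def c fourier_integral_def K_def integral_mult_right_zero[symmetric] by (simp add: mult.commute)
  have "integrable collision_space (\<lambda>(v, w, \<omega>). complex_of_real (f v * h w) * \<kappa> (v - w, \<omega>))"
    unfolding collision_space_def
    by (rule integrable_mult_translate_product[OF sphere_measure.sigma_finite_measure_axioms _ f(2) _ h(2) \<kappa>]) simp_all
  from integrable_cis_mult[OF _ this, of "\<lambda>p. - (\<zeta> \<bullet> fst p)"]
  show int1: ?int1 by (simp add: case_prod_beta')
  have ceq: "fourier f (\<zeta> - \<xi>) * fourier h \<xi> * X \<xi> = complex_of_real (c * c * c) *
      (fourier_integral (\<lambda>v. complex_of_real (f v)) (\<zeta> - \<xi>) * fourier_integral (\<lambda>v. complex_of_real (h v)) \<xi>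
        * fourier_integral K \<xi>)" for \<xi>
    unfolding fourier_eq X c_def[symmetric] by simp
  show ?int2
    unfolding ceq by (intro integrable_mult_right integrable_weighted_convolution f h K)
  have "integrable (lborel \<Otimes>\<^sub>M lborel) (\<lambda>(v, w). (cis (- (\<zeta> \<bullet> v)) * complex_of_real (f v)) * (complex_of_real (h w) * K (v - w)))"
    by (rule integrable_mult_translate[of f]) (use f h K in \<open>auto simp: norm_mult\<close>)
  from lborel_pair.integral_fst[OF this]
  have "(LINT p|(lborel \<Otimes>\<^sub>M lborel). (case p of (v, w) \<Rightarrow>
            cis (- (\<zeta> \<bullet> v)) * complex_of_real (f v) * (complex_of_real (h w) * K (v - w))))
      = (LINT v|lborel. LINT w|lborel. cis (- (\<zeta> \<bullet> v)) * complex_of_real (f v) * (complex_of_real (h w) * K (v - w)))" ..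
  also have "\<dots> = (LINT v|lborel. LINT w|lborel. LINT \<omega>|sphere_measure.
      cis (- (\<zeta> \<bullet> v)) * (complex_of_real (f v * h w) * \<kappa> (v - w, \<omega>)))"
    unfolding K_def integral_mult_right_zero[symmetric] by (simp add: mult_ac)
  also have "\<dots> = (LINT p|collision_space.
          (case p of (v, w, \<omega>) \<Rightarrow> cis (- (\<zeta> \<bullet> v)) * (complex_of_real (f v * h w) * \<kappa> (v - w, \<omega>))))"
    using integral_collision_space[OF int1] by simp
  finally have "(LINT \<xi>|lborel. fourier f (\<zeta> - \<xi>) * fourier h \<xi> * X \<xi>)
      = complex_of_real (c * c * c) * (complex_of_real ((2 * pi) ^ 3) * (LINT p|collision_space.
          (case p of (v, w, \<omega>) \<Rightarrow> cis (- (\<zeta> \<bullet> v)) * (complex_of_real (f v * h w) * \<kappa> (v - w, \<omega>)))))"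
    unfolding ceq integral_mult_right_zero integral_weighted_convolution[OF f h K] by simp
  also have "\<dots> = complex_of_real (c * (c * c * (2 * pi) ^ 3)) * (LINT p|collision_space.
          (case p of (v, w, \<omega>) \<Rightarrow> cis (- (\<zeta> \<bullet> v)) * (complex_of_real (f v * h w) * \<kappa> (v - w, \<omega>))))"
    by simp
  finally show ?eq
    unfolding c2 by (simp add: c_def)
qed

section \<open>Post-collisional velocities and integration against the collision measure\<close>

text \<open>Both follow from \<mu>/a = b/(a + b) and \<mu>/b = a/(a + b), which sum to 1. The centre
  of mass is thereby eliminated: the phase gained by \<open>v\<close> in a collision depends on
  relative velocities only, and the relative velocity afterwards is \<open>u'\<close>.\<close>

lemma
  fixes a b :: real
  assumes "a > 0" "b > 0"
  shows post_fst_eq: "post_fst a b v w u' = v + (reduced_mass a b / a) *\<^sub>R (u' - (v - w))"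
    and post_snd_eq: "post_snd a b v w u' = post_fst a b v w u' - u'"
proof -
  have r: "reduced_mass a b / a = b / (a + b)" "reduced_mass a b / b = a / (a + b)"
    "b / (a + b) + a / (a + b) = 1"
    using assms by (simp_all add: reduced_mass_def add.commute flip: add_divide_distrib)
  have "v + (reduced_mass a b / a) *\<^sub>R (u' - (v - w)) - post_fst a b v w u'
      = v - (reduced_mass a b / a) *\<^sub>R v + (reduced_mass a b / a) *\<^sub>R w - (a / (a + b)) *\<^sub>R v - (b / (a + b)) *\<^sub>R w"
    by (simp add: post_fst_def algebra_simps divide_inverse)
  also note r(1)
  also have "v - (b / (a + b)) *\<^sub>R v + (b / (a + b)) *\<^sub>R w - (a / (a + b)) *\<^sub>R v - (b / (a + b)) *\<^sub>R w
      = v - (b / (a + b) + a / (a + b)) *\<^sub>R v"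
    by (simp add: algebra_simps)
  also note r(3)
  finally show "post_fst a b v w u' = v + (reduced_mass a b / a) *\<^sub>R (u' - (v - w))" by (simp add: r(1))
  have "post_fst a b v w u' - post_snd a b v w u' = (reduced_mass a b / a + reduced_mass a b / b) *\<^sub>R u'"
    by (simp add: post_fst_def post_snd_def scaleR_add_left)
  also have "reduced_mass a b / a + reduced_mass a b / b = 1"
    unfolding r ..
  finally show "post_snd a b v w u' = post_fst a b v w u' - u'" by (simp add: algebra_simps)
qed

lemma measurable_collision_map [measurable]:
  assumes [measurable]: "s \<in> borel_measurable borel"
  shows "collision_map a b s \<in> collision_space \<rightarrow>\<^sub>M collision_space"
  unfolding collision_map_def Let_def post_fst_def post_snd_def by measurable

lemma borel_measurable_cross_section:
  fixes \<sigma> :: cross_section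
  assumes \<sigma>: "(\<lambda>(u, \<omega>). \<sigma> u \<omega>) \<in> borel_measurable (lborel \<Otimes>\<^sub>M sphere_measure)"
  shows "(\<lambda>p. \<sigma> (fst p - fst (snd p)) (snd (snd p))) \<in> borel_measurable collision_space"
proof -
  have "(\<lambda>p. (fst p - fst (snd p), snd (snd p))) \<in> collision_space \<rightarrow>\<^sub>M lborel \<Otimes>\<^sub>M sphere_measure"
    by measurable
  from measurable_compose[OF this \<sigma>] show ?thesis by simp
qed

text \<open>The sign of \<open>\<sigma>\<close> is known at unit directions only, but these carry
  all of \<open>sphere_measure\<close>, so the density is nonnegative almost everywhere.\<close>

lemma
  fixes \<sigma> :: cross_section and F :: "vec3 \<times> vec3 \<times> vec3 \<Rightarrow> complex"
  assumes \<sigma>: "(\<lambda>(u, \<omega>). \<sigma> u \<omega>) \<in> borel_measurable (lborel \<Otimes>\<^sub>M sphere_measure)"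
    and nonneg: "\<forall>u. \<forall>\<omega>\<in>sphere 0 1. \<sigma> u \<omega> \<ge> 0"
    and F: "F \<in> borel_measurable collision_space"
  shows integrable_collision_measure:
      "integrable (collision_measure \<sigma>) F \<longleftrightarrow> integrable collision_space
        (\<lambda>(v, w, \<omega>). complex_of_real (\<sigma> (v - w) \<omega> * norm (v - w)) * F (v, w, \<omega>))"
    and integral_collision_measure:
      "integral\<^sup>L (collision_measure \<sigma>) F = (LINT p|collision_space.
        (case p of (v, w, \<omega>) \<Rightarrow> complex_of_real (\<sigma> (v - w) \<omega> * norm (v - w)) * F (v, w, \<omega>)))"
proof -
  note m = borel_measurable_cross_section[OF \<sigma>]
  define d where "d p = \<sigma> (fst p - fst (snd p)) (snd (snd p)) * norm (fst p - fst (snd p))" for p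
  have [measurable]: "d \<in> borel_measurable collision_space"
    unfolding d_def[abs_def] using m by measurable
  have nn: "AE p in collision_space. 0 \<le> d p"
    using AE_collision_space by eventually_elim (use nonneg in \<open>auto simp: d_def\<close>)
  have M: "collision_measure \<sigma> = density collision_space (\<lambda>p. ennreal (d p))"
    by (simp add: collision_measure_def d_def case_prod_beta')
  show "integrable (collision_measure \<sigma>) F \<longleftrightarrow> integrable collision_space
        (\<lambda>(v, w, \<omega>). complex_of_real (\<sigma> (v - w) \<omega> * norm (v - w)) * F (v, w, \<omega>))"
    unfolding M using F nn
    by (subst integrable_density) (auto simp: d_def case_prod_beta' scaleR_conv_of_real)
  show "integral\<^sup>L (collision_measure \<sigma>) F = (LINT p|collision_space.
        (case p of (v, w, \<omega>) \<Rightarrow> complex_of_real (\<sigma> (v - w) \<omega> * norm (v - w)) * F (v, w, \<omega>)))"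
    unfolding M using F nn
    by (subst integral_density) (auto simp: d_def case_prod_beta' scaleR_conv_of_real)
qed

text \<open>Non-unit directions are null for the sphere measure, and the density vanishes where
  \<open>v = w\<close> or the cross-section is 0. Off these sets \<open>sgn (v - w)\<close> is a
  unit vector and the collision can be reversed.\<close>

lemma AE_collision_measure:
  assumes \<sigma>: "(\<lambda>(u, \<omega>). \<sigma> u \<omega>) \<in> borel_measurable (lborel \<Otimes>\<^sub>M sphere_measure)"
    and P: "\<And>v w \<omega>. \<omega> \<in> sphere 0 1 \<Longrightarrow> v \<noteq> w \<Longrightarrow> \<sigma> (v - w) \<omega> \<noteq> 0 \<Longrightarrow> P (v, w, \<omega>)"
  shows "AE p in collision_measure \<sigma>. P p"
proof -
  note m = borel_measurable_cross_section[OF \<sigma>]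
  have "(\<lambda>(v, w, \<omega>). ennreal (\<sigma> (v - w) \<omega> * norm (v - w))) \<in> borel_measurable collision_space"
    unfolding case_prod_beta' using m by measurable
  then show ?thesis
    unfolding collision_measure_def using AE_collision_space
    by (subst AE_density) (auto elim!: eventually_mono intro!: P)
qed

text \<open>If \<open>T\<close> is a measure-preserving involution, \<open>D = F \<circ> T - F\<close> is antisymmetric under \<open>T\<close>, so
  \<open>2 \<integral> E D = \<integral> (E - E \<circ> T) D\<close>.  On the right-hand side the two terms of \<open>D\<close> may be integrated
  separately even if \<open>E F\<close> is not integrable.\<close>

lemma integral_involution:
  fixes E F :: "'a \<Rightarrow> complex"
  assumes T: "T \<in> M \<rightarrow>\<^sub>M M" "distr M M T = M" "AE p in M. T (T p) = p"
    and E: "integrable M (\<lambda>p. E p * (F (T p) - F p))" "integrable M (\<lambda>p. (E (T p) - E p) * F p)"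
  shows "(LINT p|M. E p * (F (T p) - F p)) = (LINT p|M. (E (T p) - E p) * F p)"
proof -
  define A where "A p = E p * (F (T p) - F p)" for p
  define B where "B p = (E (T p) - E p) * F p" for p
  have A: "integrable M A" and B: "integrable M B" using E by (simp_all add: A_def[abs_def] B_def[abs_def])
  have comp: "integrable M (\<lambda>p. H (T p)) \<and> (LINT p|M. H (T p)) = (LINT p|M. H p)"
    if H: "integrable M H" for H :: "'a \<Rightarrow> complex"
  proof -
    have [measurable]: "H \<in> borel_measurable M" using H by auto
    show ?thesis
      using H integrable_distr_eq[OF T(1), of H] integral_distr[OF T(1), of H] unfolding T(2) by simp
  qed
  \<comment> \<open>Adding the composition with \<open>T\<close> doubles each integral, and makes
    both integrands equal to \<open>(E p - E (T p)) * (F (T p) - F p)\<close>.\<close>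
  have "(LINT p|M. A p) + (LINT p|M. A (T p)) = (LINT p|M. A p + A (T p))"
    using A comp[OF A] by simp
  also have "\<dots> = (LINT p|M. B p + B (T p))"
  proof (rule integral_cong_AE)
    show "AE p in M. A p + A (T p) = B p + B (T p)"
      using T(3) by eventually_elim (simp add: A_def B_def algebra_simps)
    show "(\<lambda>p. A p + A (T p)) \<in> borel_measurable M" "(\<lambda>p. B p + B (T p)) \<in> borel_measurable M"
      using A B comp[OF A] comp[OF B] by auto
  qed
  also have "\<dots> = (LINT p|M. B p) + (LINT p|M. B (T p))"
    using B comp[OF B] by simp
  finally show ?thesis
    using comp[OF A] comp[OF B] by (simp add: A_def B_def)
qed

section \<open>The collision operators\<close>

text \<open>The first collision has outgoing relative velocity \<open>u'\<close> and remembers the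
  direction of \<open>v - w\<close>. The second takes \<open>u'\<close> as incoming, restores
  \<open>v - w\<close> from that direction and the conserved speed, and returns
  \<open>\<omega>\<close> as the direction of \<open>u'\<close>. For \<open>v = w\<close> both
  directions would be lost.\<close>

lemma collision_map_id_involution:
  assumes "a > 0" "b > 0" "\<omega> \<in> sphere 0 1" "v \<noteq> w"
  shows "collision_map a b (\<lambda>u. u) (collision_map a b (\<lambda>u. u) (v, w, \<omega>)) = (v, w, \<omega>)"
proof -
  define u' where "u' = norm (v - w) *\<^sub>R \<omega>"
  have n: "norm u' = norm (v - w)" and sg: "sgn u' = \<omega>"
    using assms by (auto simp: u'_def sgn_div_norm)
  have u_eq: "norm (v - w) *\<^sub>R sgn (v - w) = v - w"
    using assms by (simp add: sgn_div_norm)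
  show ?thesis
    using assms
    by (simp add: collision_map_def Let_def post_snd_eq post_fst_eq n sg u_eq flip: u'_def scaleR_add_right)
qed

text \<open>With respect to the collision measure the transformed operator integrates
  \<open>E * (F \<circ> T - F)\<close>, where \<open>E\<close> is the Fourier phase and
  \<open>F\<close> the product of the distributions, while the weight belongs to
  \<open>(E \<circ> T - E) * F\<close>. The collision map is an involution preserving that measure,
  so the two integrals agree; convergence of \<open>Q\<close> and of the weight provides exactly the
  two integrability conditions.\<close>

lemma elastic_fourier:
  fixes i j :: nat and \<zeta> :: vec3
  assumes m: "m i > 0" "m j > 0"
    and f: "integrable lborel (f i)" "integrable lborel (\<lambda>v. (f i v)\<^sup>2)"
      "integrable lborel (f j)" "integrable lborel (\<lambda>v. (f j v)\<^sup>2)"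
    and \<sigma>: "(\<lambda>(u, \<omega>'). \<sigma> i j u \<omega>') \<in> borel_measurable (lborel \<Otimes>\<^sub>M sphere_measure)"
      "\<forall>u. \<forall>\<omega>'\<in>sphere 0 1. \<sigma> i j u \<omega>' \<ge> 0"
    and rev: "elastic_reversible m \<sigma> i j"
    and Q: "integrable collision_space (\<lambda>(v, w, \<omega>'). Q_elastic_integrand m \<sigma> f i j v w \<omega>')"
    and W: "integrable (lborel \<Otimes>\<^sub>M sphere_measure) (\<lambda>(u, \<omega>'). W_integrand m \<sigma> i j \<zeta> 0 u \<omega>')"
  shows "fourier (Q_elastic m \<sigma> f i j) \<zeta> =
    (LINT \<xi>|lborel. fourier (f i) (\<zeta> - \<xi>) * fourier (f j) \<xi> * W_weight m \<sigma> i j \<zeta> \<xi>)"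
proof -
  define M where "M = collision_measure (\<sigma> i j)"
  define T where "T = collision_map (m i) (m j) (\<lambda>u. u)"
  define E where "E = (\<lambda>p :: vec3 \<times> vec3 \<times> vec3. cis (- (\<zeta> \<bullet> fst p)))"
  define F where "F = (\<lambda>(v, w, \<omega>' :: vec3). complex_of_real (f i v * f j w))"
  define \<kappa> where "\<kappa> = (\<lambda>(u, \<omega>'). W_integrand m \<sigma> i j \<zeta> 0 u \<omega>')"
  have [measurable]: "f i \<in> borel_measurable borel" "f j \<in> borel_measurable borel"
    using borel_measurable_integrable[OF f(1)] borel_measurable_integrable[OF f(3)] by simp_all
  have T: "T \<in> collision_space \<rightarrow>\<^sub>M collision_space"
    unfolding T_def by measurable
  have [measurable]: "E \<in> borel_measurable collision_space" "F \<in> borel_measurable collision_space"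
    unfolding E_def F_def by measurable
  have ET: "(\<lambda>p. E (T p)) \<in> borel_measurable collision_space"
    and FT: "(\<lambda>p. F (T p)) \<in> borel_measurable collision_space"
    using T by (auto intro: measurable_compose)
  have sets_M: "sets M = sets collision_space"
    by (simp add: M_def collision_measure_def)
  have TM: "T \<in> M \<rightarrow>\<^sub>M M"
    using T by (simp add: sets_M cong: measurable_cong_sets)
  \<comment> \<open>The target of \<open>distr\<close> matters only through its measurable sets,
    which \<open>M\<close> shares with \<open>collision_space\<close>.\<close>
  have inv: "distr M M T = M"
    using rev unfolding elastic_reversible_def M_def T_def
    by (metis M_def distr_cong sets_M)
  have invol: "AE p in M. T (T p) = p"
    unfolding M_def T_def
    by (rule AE_collision_measure[OF \<sigma>(1)]) (rule collision_map_id_involution[OF m])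
  have gain: "complex_of_real (\<sigma> i j (v - w) \<omega>' * norm (v - w)) *
        (E (v, w, \<omega>') * (F (T (v, w, \<omega>')) - F (v, w, \<omega>')))
      = cis (- (\<zeta> \<bullet> v)) * complex_of_real (Q_elastic_integrand m \<sigma> f i j v w \<omega>')" for v w \<omega>'
    by (simp add: E_def F_def T_def collision_map_def Q_elastic_integrand_def Let_def)
  \<comment> \<open>Here the factor exp[...] - 1 of the weight arises: it is the change of the
    Fourier phase under a collision, divided by the phase before it.\<close>
  have phase: "complex_of_real (\<sigma> i j (v - w) \<omega>' * norm (v - w)) *
        ((E (T (v, w, \<omega>')) - E (v, w, \<omega>')) * F (v, w, \<omega>'))
      = cis (- (\<zeta> \<bullet> v)) * (complex_of_real (f i v * f j w) * \<kappa> (v - w, \<omega>'))" for v w \<omega>'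
  proof -
    let ?d = "reduced_mass (m i) (m j) / m i * (\<zeta> \<bullet> (norm (v - w) *\<^sub>R \<omega>' - (v - w)))"
    have "E (T (v, w, \<omega>')) = cis (- (\<zeta> \<bullet> v)) * cis (- ?d)"
      by (simp add: E_def T_def collision_map_def Let_def post_fst_eq[OF m] cis_mult inner_add_right)
    then have "E (T (v, w, \<omega>')) - E (v, w, \<omega>') = cis (- (\<zeta> \<bullet> v)) * (cis (- ?d) - 1)"
      by (simp add: E_def right_diff_distrib)
    moreover have "\<kappa> (v - w, \<omega>') = complex_of_real (norm (v - w) * \<sigma> i j (v - w) \<omega>') * (cis (- ?d) - 1)"
      unfolding \<kappa>_def W_integrand_def Let_def exp_neg_ii by simp
    ultimately show ?thesis
      by (simp add: F_def mult_ac)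
  qed
  note col_int = integrable_collision_measure[OF \<sigma>, folded M_def]
    and col_eq = integral_collision_measure[OF \<sigma>, folded M_def]
  have m1: "(\<lambda>p. E p * (F (T p) - F p)) \<in> borel_measurable collision_space"
    and m2: "(\<lambda>p. (E (T p) - E p) * F p) \<in> borel_measurable collision_space"
    using ET FT by measurable
  have i1: "integrable M (\<lambda>p. E p * (F (T p) - F p))"
    unfolding col_int[OF m1] gain
    using integrable_cis_mult[OF _ integrable_of_real[OF Q], of "\<lambda>p. - (\<zeta> \<bullet> fst p)"]
    by (simp add: case_prod_beta')
  have i2: "integrable M (\<lambda>p. (E (T p) - E p) * F p)"
    unfolding col_int[OF m2] phase
    by (rule integrable_collision_kernel[OF f]) (use W in \<open>simp add: \<kappa>_def\<close>)
  have "fourier (Q_elastic m \<sigma> f i j) \<zeta> = complex_of_real ((2 * pi) powr (-3/2)) *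
      (LINT p|collision_space. cis (- (\<zeta> \<bullet> fst p)) *
        complex_of_real (case p of (v, w, \<omega>') \<Rightarrow> Q_elastic_integrand m \<sigma> f i j v w \<omega>'))"
    unfolding Q_elastic_def[abs_def] using fourier_collision_integral[OF Q, of \<zeta>] by simp
  also have "(LINT p|collision_space. cis (- (\<zeta> \<bullet> fst p)) *
        complex_of_real (case p of (v, w, \<omega>') \<Rightarrow> Q_elastic_integrand m \<sigma> f i j v w \<omega>'))
      = (LINT p|M. E p * (F (T p) - F p))"
    unfolding col_eq[OF m1] gain by (simp add: case_prod_beta')
  also have "\<dots> = (LINT p|M. (E (T p) - E p) * F p)"
    by (rule integral_involution[OF TM inv invol i1 i2])
  also have "\<dots> = (LINT p|collision_space. (case p of (v, w, \<omega>') \<Rightarrow>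
      cis (- (\<zeta> \<bullet> v)) * (complex_of_real (f i v * f j w) * \<kappa> (v - w, \<omega>'))))"
    unfolding col_eq[OF m2] phase ..
  also have "complex_of_real ((2 * pi) powr (-3/2)) * \<dots> = (LINT \<xi>|lborel. fourier (f i) (\<zeta> - \<xi>) * fourier (f j) \<xi> *
      (complex_of_real (1 / (2 * pi) powr (3/2)) *
        (LINT u|lborel. LINT \<omega>'|sphere_measure. \<kappa> (u, \<omega>') * cis (- (\<xi> \<bullet> u)))))"
    by (rule integral_fourier_convolution[OF f, symmetric]) (use W in \<open>simp add: \<kappa>_def\<close>)
  also have "\<dots> = (LINT \<xi>|lborel. fourier (f i) (\<zeta> - \<xi>) * fourier (f j) \<xi> * W_weight m \<sigma> i j \<zeta> \<xi>)"
    unfolding W_weight_def \<kappa>_def W_integrand_def Let_def exp_neg_ii by simp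
  finally show ?thesis .
qed

text \<open>Gain and loss each converge absolutely, the loss by the kernel of
  \<open>i + j \<rightarrow> k + l\<close> and the gain by that of the inverse collision, so they
  can be treated separately. Only the gain needs a change of variables, and transport of
  \<open>M1\<close> to \<open>M2\<close> supplies it without computing a Jacobian.\<close>

lemma inelastic_fourier:
  fixes i j k l :: nat and \<zeta> :: vec3
  assumes m: "m i > 0" "m j > 0"
    and g: "g i > 0" "g j > 0" "g k > 0" "g l > 0"
    and fi: "integrable lborel (f i)" "integrable lborel (\<lambda>v. (f i v)\<^sup>2)"
    and fj: "integrable lborel (f j)" "integrable lborel (\<lambda>v. (f j v)\<^sup>2)"
    and fk: "integrable lborel (f k)" "integrable lborel (\<lambda>v. (f k v)\<^sup>2)"
    and fl: "integrable lborel (f l)" "integrable lborel (\<lambda>v. (f l v)\<^sup>2)"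
    and \<tau>: "(\<lambda>(u, \<omega>'). \<tau> i j k l u \<omega>') \<in> borel_measurable (lborel \<Otimes>\<^sub>M sphere_measure)"
      "\<forall>u. \<forall>\<omega>'\<in>sphere 0 1. \<tau> i j k l u \<omega>' \<ge> 0"
    and \<tau>_inv: "(\<lambda>(u, \<omega>'). \<tau> k l i j u \<omega>') \<in> borel_measurable (lborel \<Otimes>\<^sub>M sphere_measure)"
      "\<forall>u. \<forall>\<omega>'\<in>sphere 0 1. \<tau> k l i j u \<omega>' \<ge> 0"
    and threshold: "\<And>u \<omega>'. \<omega>' \<in> sphere 0 1 \<Longrightarrow>
        (norm u)\<^sup>2 < 2 * energy_gap E i j k l / reduced_mass (m i) (m j) \<Longrightarrow> \<tau> i j k l u \<omega>' = 0"
    and rev: "inelastic_reversible m E g \<tau> i j k l"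
    and L: "integrable (lborel \<Otimes>\<^sub>M sphere_measure) (\<lambda>(u, \<omega>'). L_integrand \<tau> i j k l 0 u \<omega>')"
    and L_inv: "integrable (lborel \<Otimes>\<^sub>M sphere_measure) (\<lambda>(u, \<omega>'). L_integrand \<tau> k l i j 0 u \<omega>')"
  shows "fourier (Q_inelastic m E g \<tau> f i j k l) \<zeta> =
    (LINT \<xi>|lborel.
       fourier (f k) (\<zeta> - \<xi>) * fourier (f l) \<xi> * G_weight m E \<tau> i j k l \<zeta> \<xi>
       - fourier (f i) (\<zeta> - \<xi>) * fourier (f j) \<xi> * L_weight \<tau> i j k l \<xi>)"
proof -
  define \<mu> where "\<mu> = reduced_mass (m i) (m j)"
  define \<Delta> where "\<Delta> = energy_gap E i j k l"
  define M1 where "M1 = collision_measure (\<lambda>u \<omega>'. g i * g j * \<tau> i j k l u \<omega>')"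
  define M2 where "M2 = collision_measure (\<lambda>u' \<omega>. g k * g l * \<tau> k l i j u' \<omega>)"
  define T where "T = collision_map (m i) (m j) (inelastic_speed \<mu> \<Delta>)"
  define d where "d u' \<omega> = \<mu> / m i * (\<zeta> \<bullet> (sqrt ((norm u')\<^sup>2 + 2 * \<Delta> / \<mu>) *\<^sub>R \<omega> - u'))" for u' \<omega> :: vec3
  define \<kappa> where "\<kappa> = (\<lambda>(u', \<omega>). complex_of_real (norm u' * \<tau> k l i j u' \<omega>) * cis (- d u' \<omega>))"
  define \<Lambda> where "\<Lambda> = (\<lambda>(u, \<omega>'). L_integrand \<tau> i j k l 0 u \<omega>')"
  \<comment> \<open>A function of the variables of the inverse collision, chosen such that composing
    it with \<open>T\<close> gives the gain integrand: the phase \<open>d\<close> leads from the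
    velocity after the collision back to the one before it.\<close>
  define H where "H = (\<lambda>(v, w, \<omega>). cis (- (\<zeta> \<bullet> v)) * (complex_of_real (f k v * f l w) * cis (- d (v - w) \<omega>)))"
  define gain where "gain p = f k (fst (T p)) * f l (fst (snd (T p)))
      * (\<tau> i j k l (fst p - fst (snd p)) (snd (snd p)) * norm (fst p - fst (snd p)))" for p
  define loss where "loss = (\<lambda>(v, w, \<omega>'). f i v * f j w * (\<tau> i j k l (v - w) \<omega>' * norm (v - w)))"
  let ?c = "complex_of_real ((2 * pi) powr (-3/2))"
  have [measurable]: "f i \<in> borel_measurable borel" "f j \<in> borel_measurable borel"
    "f k \<in> borel_measurable borel" "f l \<in> borel_measurable borel"
    using borel_measurable_integrable[OF fi(1)] borel_measurable_integrable[OF fj(1)]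
      borel_measurable_integrable[OF fk(1)] borel_measurable_integrable[OF fl(1)] by simp_all
  have [measurable]: "inelastic_speed \<mu> \<Delta> \<in> borel_measurable borel"
    unfolding inelastic_speed_def[abs_def] by measurable
  have T[measurable]: "T \<in> collision_space \<rightarrow>\<^sub>M collision_space"
    unfolding T_def by measurable
  have H[measurable]: "H \<in> borel_measurable collision_space"
    unfolding H_def d_def case_prod_beta' by measurable
  have HT: "(\<lambda>p. H (T p)) \<in> borel_measurable collision_space"
    using T H by (rule measurable_compose)
  have sig1: "(\<lambda>(u, \<omega>'). g i * g j * \<tau> i j k l u \<omega>') \<in> borel_measurable (lborel \<Otimes>\<^sub>M sphere_measure)"
    using \<tau>(1) unfolding case_prod_beta' by measurable
  have sig2: "(\<lambda>(u, \<omega>'). g k * g l * \<tau> k l i j u \<omega>') \<in> borel_measurable (lborel \<Otimes>\<^sub>M sphere_measure)"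
    using \<tau>_inv(1) unfolding case_prod_beta' by measurable
  have nn1: "\<forall>u. \<forall>\<omega>'\<in>sphere 0 1. g i * g j * \<tau> i j k l u \<omega>' \<ge> 0"
    using \<tau>(2) g by simp
  have nn2: "\<forall>u. \<forall>\<omega>'\<in>sphere 0 1. g k * g l * \<tau> k l i j u \<omega>' \<ge> 0"
    using \<tau>_inv(2) g by simp
  note int1 = integrable_collision_measure[OF sig1 nn1, folded M1_def]
    and eq1 = integral_collision_measure[OF sig1 nn1, folded M1_def]
    and int2 = integrable_collision_measure[OF sig2 nn2, folded M2_def]
    and eq2 = integral_collision_measure[OF sig2 nn2, folded M2_def]
  have distr: "distr M1 collision_space T = M2"
    using rev unfolding inelastic_reversible_def M1_def M2_def T_def \<mu>_def \<Delta>_def .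
  have TM: "T \<in> M1 \<rightarrow>\<^sub>M collision_space"
    using T by (simp add: M1_def collision_measure_def)

  \<comment> \<open>The gain kernel is the loss kernel of the inverse collision at \<xi> = 0 times a
    factor of modulus 1.\<close>
  have \<kappa>: "integrable (lborel \<Otimes>\<^sub>M sphere_measure) \<kappa>"
  proof -
    have "(\<lambda>p. - d (fst p) (snd p)) \<in> borel_measurable (lborel \<Otimes>\<^sub>M sphere_measure)"
      unfolding d_def by measurable
    from integrable_cis_mult[OF this L_inv] show ?thesis
      by (simp add: \<kappa>_def L_integrand_def case_prod_beta' mult.commute)
  qed
  have \<Lambda>: "integrable (lborel \<Otimes>\<^sub>M sphere_measure) \<Lambda>"
    using L by (simp add: \<Lambda>_def)
  note kernel_gain = integrable_collision_kernel[OF fk fl \<kappa>, of \<zeta>]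
    and kernel_loss = integrable_collision_kernel[OF fi fj \<Lambda>, of \<zeta>]

  have H2: "complex_of_real (g k * g l * \<tau> k l i j (v - w) \<omega> * norm (v - w)) * H (v, w, \<omega>)
      = complex_of_real (g k * g l) * (cis (- (\<zeta> \<bullet> v)) * (complex_of_real (f k v * f l w) * \<kappa> (v - w, \<omega>)))" for v w \<omega>
    by (simp add: H_def \<kappa>_def mult_ac)
  have "integrable M2 H"
    unfolding int2[OF H] H2
    using integrable_mult_right[OF kernel_gain, of "complex_of_real (g k * g l)"] by (simp add: case_prod_beta')
  then have HT_int: "integrable M1 (\<lambda>p. H (T p))"
    unfolding distr[symmetric] integrable_distr_eq[OF TM H] .
  have "(LINT p|M1. H (T p)) = (LINT p|M2. H p)"
    unfolding distr[symmetric] integral_distr[OF TM H] ..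
  also have "\<dots> = complex_of_real (g k * g l) * (LINT p|collision_space. (case p of (v, w, \<omega>) \<Rightarrow>
      cis (- (\<zeta> \<bullet> v)) * (complex_of_real (f k v * f l w) * \<kappa> (v - w, \<omega>))))"
    unfolding eq2[OF H] H2 by (simp add: case_prod_beta')
  finally have HT_eq: "(LINT p|M1. H (T p)) = complex_of_real (g k * g l) * (LINT p|collision_space. (case p of (v, w, \<omega>) \<Rightarrow>
      cis (- (\<zeta> \<bullet> v)) * (complex_of_real (f k v * f l w) * \<kappa> (v - w, \<omega>))))" .

  \<comment> \<open>Below the threshold the cross-section vanishes and both sides are 0. Above it,
    the square root in \<open>d\<close> inverts \<open>inelastic_speed\<close>, so the speed
    \<open>norm (v - w)\<close> is recovered exactly; this needs \<open>\<omega>'\<close> to be a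
    unit vector.\<close>
  have gainH: "complex_of_real (g i * g j * \<tau> i j k l (v - w) \<omega>' * norm (v - w)) * H (T (v, w, \<omega>'))
      = complex_of_real (g i * g j) * (cis (- (\<zeta> \<bullet> v)) * complex_of_real (gain (v, w, \<omega>')))"
    if \<omega>': "\<omega>' \<in> sphere 0 1" for v w \<omega>'
  proof (cases "\<tau> i j k l (v - w) \<omega>' = 0 \<or> v = w")
    case True
    then show ?thesis by (auto simp: gain_def)
  next
    case False
    define u' where "u' = inelastic_speed \<mu> \<Delta> (norm (v - w)) *\<^sub>R \<omega>'"
    have "(norm (v - w))\<^sup>2 \<ge> 2 * \<Delta> / \<mu>"
      using threshold[OF \<omega>', of "v - w"] False by (auto simp: \<mu>_def \<Delta>_def not_less[symmetric])
    then have "(norm u')\<^sup>2 = (norm (v - w))\<^sup>2 - 2 * \<Delta> / \<mu>"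
      using \<omega>' by (simp add: u'_def inelastic_speed_def)
    then have "sqrt ((norm u')\<^sup>2 + 2 * \<Delta> / \<mu>) *\<^sub>R sgn (v - w) = v - w"
      using False by (simp add: sgn_div_norm)
    then have d: "d u' (sgn (v - w)) = \<mu> / m i * (\<zeta> \<bullet> (v - w - u'))"
      by (simp add: d_def)
    have T: "T (v, w, \<omega>') = (post_fst (m i) (m j) v w u', post_fst (m i) (m j) v w u' - u', sgn (v - w))"
      by (simp add: T_def collision_map_def Let_def post_snd_eq[OF m] flip: u'_def)
    have "cis (- (\<zeta> \<bullet> post_fst (m i) (m j) v w u')) * cis (- (\<mu> / m i * (\<zeta> \<bullet> (v - w - u')))) = cis (- (\<zeta> \<bullet> v))"
      unfolding cis_mult post_fst_eq[OF m] \<mu>_def[symmetric]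
      by (simp add: inner_add_right inner_diff_right algebra_simps)
    then have "H (T (v, w, \<omega>')) = cis (- (\<zeta> \<bullet> v)) *
        complex_of_real (f k (fst (T (v, w, \<omega>'))) * f l (fst (snd (T (v, w, \<omega>')))))"
      unfolding T H_def by (simp add: d mult_ac)
    then show ?thesis by (simp add: gain_def mult_ac)
  qed
  note meas_\<tau> = borel_measurable_cross_section[OF \<tau>(1)]
  have "T \<in> collision_space \<rightarrow>\<^sub>M borel \<Otimes>\<^sub>M (borel \<Otimes>\<^sub>M borel)"
    using T by (simp cong: measurable_cong_sets add: sets_collision_space)
  then have "(\<lambda>p. fst (T p)) \<in> borel_measurable collision_space"
    "(\<lambda>p. fst (snd (T p))) \<in> borel_measurable collision_space"
    by (auto intro: measurable_compose)
  then have gain_meas[measurable]: "gain \<in> borel_measurable collision_space"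
    unfolding gain_def[abs_def] using meas_\<tau> by measurable
  have gainH': "AE p in collision_space.
      (case p of (v, w, \<omega>') \<Rightarrow> complex_of_real (g i * g j * \<tau> i j k l (v - w) \<omega>' * norm (v - w)) * H (T (v, w, \<omega>')))
      = complex_of_real (g i * g j) * (cis (- (\<zeta> \<bullet> fst p)) * complex_of_real (gain p))"
    using AE_collision_space
  proof eventually_elim
    case (elim p)
    obtain v w \<omega>' where p: "p = (v, w, \<omega>')" by (cases p)
    with elim gainH[of \<omega>' v w] show ?case by simp
  qed
  have meas1: "(\<lambda>p. case p of (v, w, \<omega>') \<Rightarrow> complex_of_real (g i * g j * \<tau> i j k l (v - w) \<omega>' * norm (v - w)) * H (T (v, w, \<omega>')))
      \<in> borel_measurable collision_space"
    using HT_int unfolding int1[OF HT] by (rule borel_measurable_integrable)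
  have meas2: "(\<lambda>p. complex_of_real (g i * g j) * (cis (- (\<zeta> \<bullet> fst p)) * complex_of_real (gain p))) \<in> borel_measurable collision_space"
    by measurable
  \<comment> \<open>Convergence of the gain term is not assumed: it is carried back from
    \<open>M2\<close>, and the degeneracies are positive, so the constant factor can be
    removed.\<close>
  have "integrable collision_space (\<lambda>p. complex_of_real (g i * g j) * (cis (- (\<zeta> \<bullet> fst p)) * complex_of_real (gain p)))"
    using HT_int unfolding int1[OF HT] integrable_cong_AE[OF meas1 meas2 gainH'] .
  from integrable_norm[OF this] have "integrable collision_space (\<lambda>p. \<bar>gain p\<bar>)"
    using g by (simp add: norm_mult)
  then have gain_int: "integrable collision_space gain"
    by (rule Bochner_Integration.integrable_bound) (auto simp: norm_mult)
  have gain_eq: "complex_of_real (g i * g j / (g k * g l)) *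
      (LINT p|collision_space. cis (- (\<zeta> \<bullet> fst p)) * complex_of_real (gain p))
      = (LINT p|collision_space. (case p of (v, w, \<omega>) \<Rightarrow>
      cis (- (\<zeta> \<bullet> v)) * (complex_of_real (f k v * f l w) * \<kappa> (v - w, \<omega>))))"
  proof -
    have "(LINT p|M1. H (T p)) = complex_of_real (g i * g j) *
        (LINT p|collision_space. cis (- (\<zeta> \<bullet> fst p)) * complex_of_real (gain p))"
      unfolding eq1[OF HT] integral_cong_AE[OF meas1 meas2 gainH'] by simp
    \<comment> \<open>Transport yields \<open>g i * g j\<close> on one side and
      \<open>g k * g l\<close> on the other; their quotient is the factor of the gain term in the
      collision operator.\<close>
    then show ?thesis
      using g unfolding HT_eq by (simp add: field_simps)
  qed

  have loss_eq: "complex_of_real (f i v * f j w) * \<Lambda> (v - w, \<omega>') = complex_of_real (loss (v, w, \<omega>'))" for v w \<omega>'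
    by (simp add: \<Lambda>_def L_integrand_def loss_def mult_ac)
  have loss_meas: "loss \<in> borel_measurable collision_space"
    unfolding loss_def case_prod_beta' using meas_\<tau> by measurable
  have loss_int: "integrable collision_space loss"
    using kernel_loss loss_meas unfolding loss_eq
    by (rule Bochner_Integration.integrable_bound) (auto simp: norm_mult)

  define q where "q p = g i * g j / (g k * g l) * gain p - loss p" for p
  have q_int: "integrable collision_space q"
    unfolding q_def[abs_def] by (intro Bochner_Integration.integrable_diff integrable_mult_right gain_int loss_int)
  have "Q_inelastic m E g \<tau> f i j k l = (\<lambda>v. LINT w|lborel. LINT \<omega>'|sphere_measure. q (v, w, \<omega>'))"
    by (rule ext) (simp add: Q_inelastic_def q_def gain_def loss_def T_def collision_map_def Let_def
        \<mu>_def \<Delta>_def algebra_simps)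
  then have "fourier (Q_inelastic m E g \<tau> f i j k l) \<zeta>
      = ?c * (LINT p|collision_space. cis (- (\<zeta> \<bullet> fst p)) * complex_of_real (q p))"
    using fourier_collision_integral[OF q_int] by simp
  also have "(LINT p|collision_space. cis (- (\<zeta> \<bullet> fst p)) * complex_of_real (q p))
      = (LINT p|collision_space. complex_of_real (g i * g j / (g k * g l)) * (cis (- (\<zeta> \<bullet> fst p)) * complex_of_real (gain p))
          - cis (- (\<zeta> \<bullet> fst p)) * complex_of_real (loss p))"
    by (simp add: q_def algebra_simps)
  also have "\<dots> = complex_of_real (g i * g j / (g k * g l)) *
      (LINT p|collision_space. cis (- (\<zeta> \<bullet> fst p)) * complex_of_real (gain p))
      - (LINT p|collision_space. cis (- (\<zeta> \<bullet> fst p)) * complex_of_real (loss p))"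
    using integrable_cis_mult[OF _ integrable_of_real[OF gain_int], of "\<lambda>p. - (\<zeta> \<bullet> fst p)"]
      integrable_cis_mult[OF _ integrable_of_real[OF loss_int], of "\<lambda>p. - (\<zeta> \<bullet> fst p)"]
    by (subst Bochner_Integration.integral_diff) auto
  also have "(LINT p|collision_space. cis (- (\<zeta> \<bullet> fst p)) * complex_of_real (loss p))
      = (LINT p|collision_space. (case p of (v, w, \<omega>') \<Rightarrow>
          cis (- (\<zeta> \<bullet> v)) * (complex_of_real (f i v * f j w) * \<Lambda> (v - w, \<omega>'))))"
    unfolding loss_eq by (simp add: case_prod_beta')
  finally have "fourier (Q_inelastic m E g \<tau> f i j k l) \<zeta> =
      ?c * (LINT p|collision_space. (case p of (v, w, \<omega>) \<Rightarrow>
        cis (- (\<zeta> \<bullet> v)) * (complex_of_real (f k v * f l w) * \<kappa> (v - w, \<omega>))))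
      - ?c * (LINT p|collision_space. (case p of (v, w, \<omega>') \<Rightarrow>
        cis (- (\<zeta> \<bullet> v)) * (complex_of_real (f i v * f j w) * \<Lambda> (v - w, \<omega>'))))"
    unfolding gain_eq by (simp only: right_diff_distrib)
  moreover have "G_weight m E \<tau> i j k l \<zeta> \<xi> = complex_of_real (1 / (2 * pi) powr (3/2)) *
      (LINT u|lborel. LINT \<omega>|sphere_measure. \<kappa> (u, \<omega>) * cis (- (\<xi> \<bullet> u)))" for \<xi>
    unfolding G_weight_def Let_def exp_neg_ii \<kappa>_def d_def \<mu>_def \<Delta>_def by simp
  moreover have "L_weight \<tau> i j k l \<xi> = complex_of_real (1 / (2 * pi) powr (3/2)) *
      (LINT u|lborel. LINT \<omega>'|sphere_measure. \<Lambda> (u, \<omega>') * cis (- (\<xi> \<bullet> u)))" for \<xi>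
    unfolding L_weight_def L_integrand_def exp_neg_ii \<Lambda>_def by simp
  ultimately show ?thesis
    using integrable_fourier_convolution[OF fk fl \<kappa>, of \<zeta>] integrable_fourier_convolution[OF fi fj \<Lambda>, of \<zeta>]
      integral_fourier_convolution[OF fk fl \<kappa>, of \<zeta>] integral_fourier_convolution[OF fi fj \<Lambda>, of \<zeta>]
    by simp
qed

section \<open>The result for all species and all collisions\<close>

text \<open>The excluded triples are those with \<open>k = i\<close> and \<open>l = j\<close>, a
  condition symmetric under exchange of incoming and outgoing pairs. Assumptions made for all
  inelastic collisions thus apply to the cross-section of the inverse collision as well.\<close>

lemma inverse_inelastic_collision:
  assumes "i \<in> species N" "(j, k, l) \<in> inelastic_collisions N i"
  shows "k \<in> species N" "(l, i, j) \<in> inelastic_collisions N k"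
  using assms by (auto simp: inelastic_collisions_def)

theorem proposition3p1:
  fixes N :: nat
    and m E g :: "nat \<Rightarrow> real"
    and f :: "nat \<Rightarrow> vec3 \<Rightarrow> real"
    and \<sigma> :: "nat \<Rightarrow> nat \<Rightarrow> cross_section"
    and \<tau> :: "nat \<Rightarrow> nat \<Rightarrow> nat \<Rightarrow> nat \<Rightarrow> cross_section"
  assumes mass_pos: "\<forall>i\<in>species N. m i > 0"
    and degeneracy_pos: "\<forall>i\<in>species N. g i > 0"
    and f_integrable: "\<forall>i\<in>species N. integrable lborel (f i)"
    and f_square_integrable: "\<forall>i\<in>species N. integrable lborel (\<lambda>v. (f i v)\<^sup>2)"
    and elastic_measurable: "\<forall>i\<in>species N. \<forall>j\<in>species N.
      (\<lambda>(u, \<omega>'). \<sigma> i j u \<omega>') \<in> borel_measurable (lborel \<Otimes>\<^sub>M sphere_measure)"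
    and elastic_nonneg: "\<forall>i\<in>species N. \<forall>j\<in>species N. \<forall>u. \<forall>\<omega>'\<in>sphere 0 1. \<sigma> i j u \<omega>' \<ge> 0"
    and elastic_reversibility: "\<forall>i\<in>species N. \<forall>j\<in>species N. elastic_reversible m \<sigma> i j"
    and Q_converges: "\<forall>i\<in>species N. \<forall>j\<in>species N.
      integrable collision_space (\<lambda>(v, w, \<omega>'). Q_elastic_integrand m \<sigma> f i j v w \<omega>')"
    and W_converges: "\<forall>i\<in>species N. \<forall>j\<in>species N. \<forall>\<zeta> \<xi>.
      integrable (lborel \<Otimes>\<^sub>M sphere_measure) (\<lambda>(u, \<omega>'). W_integrand m \<sigma> i j \<zeta> \<xi> u \<omega>')"
    and inelastic_measurable: "\<forall>i\<in>species N. \<forall>(j, k, l)\<in>inelastic_collisions N i.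
      (\<lambda>(u, \<omega>'). \<tau> i j k l u \<omega>') \<in> borel_measurable (lborel \<Otimes>\<^sub>M sphere_measure)"
    and inelastic_nonneg: "\<forall>i\<in>species N. \<forall>(j, k, l)\<in>inelastic_collisions N i.
      \<forall>u. \<forall>\<omega>'\<in>sphere 0 1. \<tau> i j k l u \<omega>' \<ge> 0"
    and inelastic_threshold: "\<forall>i\<in>species N. \<forall>(j, k, l)\<in>inelastic_collisions N i.
      \<forall>u. \<forall>\<omega>'\<in>sphere 0 1.
        (norm u)\<^sup>2 < 2 * energy_gap E i j k l / reduced_mass (m i) (m j) \<longrightarrow> \<tau> i j k l u \<omega>' = 0"
    and inelastic_reversibility: "\<forall>i\<in>species N. \<forall>(j, k, l)\<in>inelastic_collisions N i.
      inelastic_reversible m E g \<tau> i j k l"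
    and L_converges: "\<forall>i\<in>species N. \<forall>(j, k, l)\<in>inelastic_collisions N i. \<forall>\<xi>.
      integrable (lborel \<Otimes>\<^sub>M sphere_measure) (\<lambda>(u, \<omega>'). L_integrand \<tau> i j k l \<xi> u \<omega>')"
    and gas: "(\<forall>i\<in>species N. \<forall>j\<in>species N. m i = m j) \<or>
      (\<forall>i\<in>species N. \<forall>(j, k, l)\<in>inelastic_collisions N i.
        \<forall>u. \<forall>\<omega>'\<in>sphere 0 1. \<tau> i j k l u \<omega>' = 0)"
  shows "(\<forall>i\<in>species N. \<forall>j\<in>species N. \<forall>\<zeta>.
            fourier (Q_elastic m \<sigma> f i j) \<zeta> =
            (LINT \<xi>|lborel. fourier (f i) (\<zeta> - \<xi>) * fourier (f j) \<xi> * W_weight m \<sigma> i j \<zeta> \<xi>)) \<and>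
         (\<forall>i\<in>species N. \<forall>(j, k, l)\<in>inelastic_collisions N i. \<forall>\<zeta>.
            fourier (Q_inelastic m E g \<tau> f i j k l) \<zeta> =
            (LINT \<xi>|lborel.
               fourier (f k) (\<zeta> - \<xi>) * fourier (f l) \<xi> * G_weight m E \<tau> i j k l \<zeta> \<xi>
               - fourier (f i) (\<zeta> - \<xi>) * fourier (f j) \<xi> * L_weight \<tau> i j k l \<xi>))"
proof (intro conjI ballI allI)
  fix i j \<zeta>
  assume "i \<in> species N" "j \<in> species N"
  then show "fourier (Q_elastic m \<sigma> f i j) \<zeta> =
      (LINT \<xi>|lborel. fourier (f i) (\<zeta> - \<xi>) * fourier (f j) \<xi> * W_weight m \<sigma> i j \<zeta> \<xi>)"
    using mass_pos f_integrable f_square_integrable elastic_measurable elastic_nonneg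
      elastic_reversibility Q_converges W_converges
    by (intro elastic_fourier) blast+
next
  fix i c
  assume i: "i \<in> species N" and c: "c \<in> inelastic_collisions N i"
  obtain j k l where jkl: "c = (j, k, l)" by (cases c)
  have coll: "(j, k, l) \<in> inelastic_collisions N i" using c jkl by simp
  note inv = inverse_inelastic_collision[OF i coll]
  have sp: "j \<in> species N" "k \<in> species N" "l \<in> species N"
    using coll by (auto simp: inelastic_collisions_def)
  have "fourier (Q_inelastic m E g \<tau> f i j k l) \<zeta> =
      (LINT \<xi>|lborel.
         fourier (f k) (\<zeta> - \<xi>) * fourier (f l) \<xi> * G_weight m E \<tau> i j k l \<zeta> \<xi>
         - fourier (f i) (\<zeta> - \<xi>) * fourier (f j) \<xi> * L_weight \<tau> i j k l \<xi>)" for \<zeta>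
  proof (rule inelastic_fourier)
    show "(\<lambda>(u, \<omega>'). \<tau> i j k l u \<omega>') \<in> borel_measurable (lborel \<Otimes>\<^sub>M sphere_measure)"
      "(\<lambda>(u, \<omega>'). \<tau> k l i j u \<omega>') \<in> borel_measurable (lborel \<Otimes>\<^sub>M sphere_measure)"
      using inelastic_measurable i coll inv by blast+
    show "\<forall>u. \<forall>\<omega>'\<in>sphere 0 1. \<tau> i j k l u \<omega>' \<ge> 0"
      "\<forall>u. \<forall>\<omega>'\<in>sphere 0 1. \<tau> k l i j u \<omega>' \<ge> 0"
      using inelastic_nonneg i coll inv by blast+
    show "\<tau> i j k l u \<omega>' = 0"
      if "\<omega>' \<in> sphere 0 1" "(norm u)\<^sup>2 < 2 * energy_gap E i j k l / reduced_mass (m i) (m j)" for u \<omega>'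
      using inelastic_threshold i coll that by blast
    show "inelastic_reversible m E g \<tau> i j k l"
      using inelastic_reversibility i coll by blast
    \<comment> \<open>The instances at \<xi> = 0 express integrability of the bare kernels; the one
      for the inverse collision controls the gain weight.\<close>
    show "integrable (lborel \<Otimes>\<^sub>M sphere_measure) (\<lambda>(u, \<omega>'). L_integrand \<tau> i j k l 0 u \<omega>')"
      "integrable (lborel \<Otimes>\<^sub>M sphere_measure) (\<lambda>(u, \<omega>'). L_integrand \<tau> k l i j 0 u \<omega>')"
      using L_converges i coll inv by blast+
  qed (use mass_pos degeneracy_pos f_integrable f_square_integrable i sp in blast)+
  then show "case c of (j, k, l) \<Rightarrow> \<forall>\<zeta>.
      fourier (Q_inelastic m E g \<tau> f i j k l) \<zeta> =
      (LINT \<xi>|lborel.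
         fourier (f k) (\<zeta> - \<xi>) * fourier (f l) \<xi> * G_weight m E \<tau> i j k l \<zeta> \<xi>
         - fourier (f i) (\<zeta> - \<xi>) * fourier (f j) \<xi> * L_weight \<tau> i j k l \<xi>)"
    by (simp add: jkl)
qed

end
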